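(* Let $\pi:M\to B$ be a surjective submersion between connected manifolds, let $\check{\mathbf g}$ be a Riemannian metric on $B$ with Laplacian $\check\Delta$, and let $\mathcal H$ be an Ehresmann connection on $\pi$. Define a sub-Riemannian structure $(\mathcal H,\mathbf h)$ on $M$ by $\mathbf h=\pi^*\check{\mathbf g}|_{\mathcal H}$. Then $$h^S\check\Delta=\Delta_{\mathbf h}',$$ where $\Delta_{\mathbf h}'$ is the sub-Laplacian of $(M,\mathcal H,\mathbf h)$ with respect to the complement $\mathcal V=\ker\pi_*$ and $h^S$ is the 2-connection on $\pi$ induced by $\mathcal H$.
   Context: An Ehresmann connection on $\pi$ is a subbundle $\mathcal H\subseteq TM$ with $TM=\mathcal H\oplus\mathcal V$, $\mathcal V=\ker\pi_*$; $h$ denotes the horizontal lift: for $\check v\in T_{\pi(x)}B$, $h_x\check v$ is the unique vector in $\mathcal H_x$ with $\pi_*h_x\check v=\check v$, and for a vector field $\check A$ on $B$, $h\check A$ is the vector field $x\mapsto h_x\check A|_{\pi(x)}$ on $M$. Let $T^2M$ denote the second order tangent bundle (sections are the smooth differential operators of order at most two without constant term). For $L\in\Gamma(T^2M)$ let $\mathbf q_L$ be the symmetric tensor with $\mathbf q_L(df,dg)=\frac12(L(fg)-fLg-gLf)$. A linear map $\varphi:T^2_bB\to T^2_xM$ is a Schwartz morphism if $\varphi(T_bB)\subseteq T_xM$ and $\mathbf q\circ\varphi=(\varphi|_{T_bB}\otimes\varphi|_{T_bB})\circ\mathbf q$. A 2-connection on $\pi$ is a splitting $h^S:\pi^*T^2B\to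 T^2M$ of $\pi_*:T^2M\to\pi^*T^2B$ that is a Schwartz morphism at every point. The 2-connection $h^S$ induced by $\mathcal H$ is the unique one with $h^S|_{TB}=h$ and $h^S\{\check A,\check Z\}=\{h\check A,h\check Z\}$ for $\check A,\check Z\in\Gamma(TB)$, where $\{X,Y\}=\frac12(XY+YX)$; equivalently $h^S(\check A\check Z)=h\check A\,h\check Z-\frac12\mathrm{pr}_{\mathcal V}[h\check A,h\check Z]$. The operator $h^S\check\Delta$ on $M$ is $x\mapsto h^S_x(\check\Delta|_{\pi(x)})$. Sub-Laplacian with respect to a complement $\mathcal V$ of $\mathcal H$: choose any Riemannian metric $\mathbf g$ on $M$ with $\mathbf g|_{\mathcal H}=\mathbf h$ and $\mathcal H^\perp=\mathcal V$, with Levi-Civita connection $\nabla$, and put $$\mathring\nabla_AZ=\mathrm{pr}_{\mathcal H}\nabla_{\mathrm{pr}_{\mathcal H}A}\mathrm{pr}_{\mathcal H}Z+\mathrm{pr}_{\mathcal V}\nabla_{\mathrm{pr}_{\mathcal V}A}\mathrm{pr}_{\mathcal V}Z+\mathrm{pr}_{\mathcal H}[\mathrm{pr}_{\mathcal V}A,\mathrm{pr}_{\mathcal H}Z]+\mathrm{pr}_{\mathcal V}[\mathrm{pr}_{\mathcal H}A,\mathrm{pr}_{\mathcal V}Z].$$ Then $\Delta_{\mathbf h}'f=\sum_{i=1}^n\mathring\nabla^2_{A_i,A_i}f$ for a local $\mathbf h$-orthonormal basis $A_1,\dots,A_n$ of $\mathcal H$, with $\mathring\nabla^2_{A,Z}=\mathring\nabla_A\mathring\nabla_Z-\mathring\nabla_{\mathring\nabla_AZ}$;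 this does not depend on $\mathbf g|_{\mathcal V}$. *)

theory Defs
  imports "HOL-Analysis.Analysis" "HOL-Library.Function_Algebras"
begin

text \<open>
  Tangent vectors and differential operators are functionals on the smooth functions, and vector
  fields are families of such functionals; the pointwise real vector space structure on a function
  type (its additive part is library material) makes subspace, span and independent available
  for them.
\<close>

instantiation "fun" :: (type, real_vector) real_vector
begin

definition scaleR_fun :: "real \<Rightarrow> ('a \<Rightarrow> 'b) \<Rightarrow> 'a \<Rightarrow> 'b" where
  "scaleR_fun c f = (\<lambda>x. c *\<^sub>R f x)"

instance
  by standard (auto simp: scaleR_fun_def fun_eq_iff scaleR_add_right scaleR_add_left)

end


section \<open>Smooth manifolds\<close>

primrec Ck_on :: "nat \<Rightarrow> 'a::real_normed_vector set \<Rightarrow> ('a \<Rightarrow> 'b::real_normed_vector) \<Rightarrow> bool" where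
  "Ck_on 0 W f \<longleftrightarrow> continuous_on W f"
| "Ck_on (Suc k) W f \<longleftrightarrow>
     (\<forall>x\<in>W. f differentiable (at x)) \<and> (\<forall>v. Ck_on k W (\<lambda>x. frechet_derivative f (at x) v))"

text \<open>
  Smoothness on an arbitrary subset of a Euclidean space: the function extends locally to a smooth
  function on an open set. For relatively open subsets of a linear subspace this is ordinary
  smoothness.
\<close>

definition smooth_on :: "'a::real_normed_vector set \<Rightarrow> ('a \<Rightarrow> 'b::real_normed_vector) \<Rightarrow> bool" where
  "smooth_on X f \<longleftrightarrow>
     (\<forall>x\<in>X. \<exists>W F. open W \<and> x \<in> W \<and> (\<forall>k. Ck_on k W F) \<and> (\<forall>y\<in>X \<inter> W. F y = f y))"

text \<open>
  A chart is a pair \<open>(U, \<phi>)\<close>. The charts take values in a linear subspace of the Euclidean space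
  \<open>'e\<close>, whose dimension is the dimension of the manifold; with a subspace instead of all of \<open>'e\<close>,
  the dimension 0 is not excluded. The underlying set of the manifold is the whole type \<open>'m\<close>.
\<close>

type_synonym ('m, 'e) atlas = "('m set \<times> ('m \<Rightarrow> 'e)) set"

definition smooth_atlas ::
    "('m::{t2_space, second_countable_topology}, 'e::euclidean_space) atlas \<Rightarrow> bool" where
  "smooth_atlas M \<longleftrightarrow>
     (\<exists>S. subspace S \<and>
        (\<forall>(U, \<phi>)\<in>M. open U \<and> \<phi> ` U \<subseteq> S \<and> openin (top_of_set S) (\<phi> ` U) \<and>
                    homeomorphism U (\<phi> ` U) \<phi> (inv_into U \<phi>))) \<and>
     (\<Union>(U, \<phi>)\<in>M. U) = UNIV \<and>
     (\<forall>(U, \<phi>)\<in>M. \<forall>(V, \<psi>)\<in>M. smooth_on (\<phi> ` (U \<inter> V)) (\<lambda>y. \<psi> (inv_into U \<phi> y)))"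

definition connected_manifold ::
    "('m::{t2_space, second_countable_topology}, 'e::euclidean_space) atlas \<Rightarrow> bool" where
  "connected_manifold M \<longleftrightarrow> smooth_atlas M \<and> connected (UNIV :: 'm set)"

definition smooth_fun :: "('m, 'e::euclidean_space) atlas \<Rightarrow> ('m \<Rightarrow> real) set" where
  "smooth_fun M = {f. \<forall>(U, \<phi>)\<in>M. smooth_on (\<phi> ` U) (\<lambda>y. f (inv_into U \<phi> y))}"

definition smooth_map ::
    "('m::topological_space, 'e::euclidean_space) atlas \<Rightarrow>
     ('b::topological_space, 'c::euclidean_space) atlas \<Rightarrow> ('m \<Rightarrow> 'b) \<Rightarrow> bool" where
  "smooth_map M B p \<longleftrightarrow> continuous_on UNIV p \<and>
     (\<forall>(U, \<phi>)\<in>M. \<forall>(V, \<psi>)\<in>B. smooth_on (\<phi> ` (U \<inter> p -` V)) (\<lambda>y. \<psi> (p (inv_into U \<phi> y))))"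


section \<open>First and second order tangent vectors\<close>

text \<open>
  Functionals are real-linear on the smooth functions; they are set to 0 outside, so that two of
  them are equal iff they agree on the smooth functions.
\<close>

type_synonym 'm functional = "('m \<Rightarrow> real) \<Rightarrow> real"
type_synonym 'm field = "'m \<Rightarrow> 'm functional"

definition functionals :: "('m, 'e::euclidean_space) atlas \<Rightarrow> 'm functional set" where
  "functionals M = {l. (\<forall>f\<in>smooth_fun M. \<forall>g\<in>smooth_fun M. l (f + g) = l f + l g) \<and>
                       (\<forall>c. \<forall>f\<in>smooth_fun M. l (c *\<^sub>R f) = c * l f) \<and>
                       (\<forall>f. f \<notin> smooth_fun M \<longrightarrow> l f = 0)}"

definition tangent_space :: "('m, 'e::euclidean_space) atlas \<Rightarrow> 'm \<Rightarrow> 'm functional set" where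
  "tangent_space M x =
     {v \<in> functionals M. \<forall>f\<in>smooth_fun M. \<forall>g\<in>smooth_fun M. v (f * g) = f x * v g + g x * v f}"

text \<open>
  The fibre at \<open>x\<close> of the second order tangent bundle: differential operators at \<open>x\<close> of order at most
  two (they annihilate the third power of the ideal of functions vanishing at \<open>x\<close>) without constant
  term (they annihilate the constants).
\<close>

definition tangent2_space :: "('m, 'e::euclidean_space) atlas \<Rightarrow> 'm \<Rightarrow> 'm functional set" where
  "tangent2_space M x =
     {l \<in> functionals M. l (\<lambda>_. 1) = 0 \<and>
        (\<forall>f\<in>smooth_fun M. \<forall>g\<in>smooth_fun M. \<forall>k\<in>smooth_fun M.
           f x = 0 \<longrightarrow> g x = 0 \<longrightarrow> k x = 0 \<longrightarrow> l (f * g * k) = 0)}"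

definition smooth_sections ::
    "('m, 'e::euclidean_space) atlas \<Rightarrow> ('m \<Rightarrow> 'm functional set) \<Rightarrow> 'm field set" where
  "smooth_sections M E =
     {X. (\<forall>x. X x \<in> E x) \<and> (\<forall>f\<in>smooth_fun M. (\<lambda>x. X x f) \<in> smooth_fun M)}"

abbreviation vector_fields :: "('m, 'e::euclidean_space) atlas \<Rightarrow> 'm field set" where
  "vector_fields M \<equiv> smooth_sections M (tangent_space M)"

abbreviation operators2 :: "('m, 'e::euclidean_space) atlas \<Rightarrow> 'm field set" where
  "operators2 M \<equiv> smooth_sections M (tangent2_space M)"

definition compose_fields :: "'m field \<Rightarrow> 'm field \<Rightarrow> 'm field" where
  "compose_fields X Y = (\<lambda>x f. X x (\<lambda>y. Y y f))"

definition bracket :: "'m field \<Rightarrow> 'm field \<Rightarrow> 'm field" where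
  "bracket X Y = compose_fields X Y - compose_fields Y X"

definition anticommutator :: "'m field \<Rightarrow> 'm field \<Rightarrow> 'm field" where
  "anticommutator X Y = (1/2) *\<^sub>R (compose_fields X Y + compose_fields Y X)"

definition fun_scale :: "('m \<Rightarrow> real) \<Rightarrow> 'm field \<Rightarrow> 'm field" where
  "fun_scale f X = (\<lambda>x. f x *\<^sub>R X x)"

text \<open>The tensor \<open>q\<close> of a second order vector at \<open>x\<close>, evaluated on the differentials of \<open>f\<close>, \<open>g\<close>.\<close>

definition symbol :: "'m \<Rightarrow> 'm functional \<Rightarrow> ('m \<Rightarrow> real) \<Rightarrow> ('m \<Rightarrow> real) \<Rightarrow> real" where
  "symbol x l f g = (l (f * g) - f x * l g - g x * l f) / 2"

text \<open>The push-forward along \<open>p\<close>, for tangent vectors as well as second order tangent vectors.\<close>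

definition push ::
    "('b, 'c::euclidean_space) atlas \<Rightarrow> ('m \<Rightarrow> 'b) \<Rightarrow> 'm functional \<Rightarrow> 'b functional" where
  "push B p l = (\<lambda>f. if f \<in> smooth_fun B then l (f \<circ> p) else 0)"

definition submersion ::
    "('m::topological_space, 'e::euclidean_space) atlas \<Rightarrow>
     ('b::topological_space, 'c::euclidean_space) atlas \<Rightarrow> ('m \<Rightarrow> 'b) \<Rightarrow> bool" where
  "submersion M B p \<longleftrightarrow>
     smooth_map M B p \<and> (\<forall>x. push B p ` tangent_space M x = tangent_space B (p x))"


section \<open>Subbundles and Ehresmann connections\<close>

text \<open>
  Local frames are given by globally defined vector fields whose frame property is only required
  near the point; every local frame agrees with such fields on a smaller neighbourhood.
\<close>

definition subbundle ::
    "('m::topological_space, 'e::euclidean_space) atlas \<Rightarrow> ('m \<Rightarrow> 'm functional set) \<Rightarrow> bool" where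
  "subbundle M H \<longleftrightarrow>
     (\<exists>r. \<forall>x. \<exists>U X. open U \<and> x \<in> U \<and> (\<forall>i<r. X i \<in> vector_fields M) \<and>
        (\<forall>y\<in>U. inj_on (\<lambda>i::nat. X i y) {..<r} \<and> independent ((\<lambda>i. X i y) ` {..<r}) \<and>
               span ((\<lambda>i. X i y) ` {..<r}) = H y))"

definition direct_sum :: "'v::real_vector set \<Rightarrow> 'v set \<Rightarrow> 'v set \<Rightarrow> bool" where
  "direct_sum E H V \<longleftrightarrow>
     subspace H \<and> subspace V \<and> H \<inter> V = {0} \<and> {a + b |a b. a \<in> H \<and> b \<in> V} = E"

definition vertical ::
    "('m, 'e::euclidean_space) atlas \<Rightarrow> ('b, 'c::euclidean_space) atlas \<Rightarrow> ('m \<Rightarrow> 'b) \<Rightarrow>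
     'm \<Rightarrow> 'm functional set" where
  "vertical M B p x = {v \<in> tangent_space M x. push B p v = 0}"

definition ehresmann_connection ::
    "('m::topological_space, 'e::euclidean_space) atlas \<Rightarrow> ('b, 'c::euclidean_space) atlas \<Rightarrow>
     ('m \<Rightarrow> 'b) \<Rightarrow> ('m \<Rightarrow> 'm functional set) \<Rightarrow> bool" where
  "ehresmann_connection M B p H \<longleftrightarrow>
     subbundle M H \<and> (\<forall>x. direct_sum (tangent_space M x) (H x) (vertical M B p x))"

text \<open>Projection to the first of two complementary subbundles, along the second.\<close>

definition pr ::
    "('m \<Rightarrow> 'm functional set) \<Rightarrow> ('m \<Rightarrow> 'm functional set) \<Rightarrow> 'm field \<Rightarrow> 'm field" where
  "pr H V X = (\<lambda>x. THE a. a \<in> H x \<and> X x - a \<in> V x)"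

definition hlift ::
    "('b, 'c::euclidean_space) atlas \<Rightarrow> ('m \<Rightarrow> 'b) \<Rightarrow> ('m \<Rightarrow> 'm functional set) \<Rightarrow>
     'm \<Rightarrow> 'b functional \<Rightarrow> 'm functional" where
  "hlift B p H x u = (THE v. v \<in> H x \<and> push B p v = u)"

definition hlift_field ::
    "('b, 'c::euclidean_space) atlas \<Rightarrow> ('m \<Rightarrow> 'b) \<Rightarrow> ('m \<Rightarrow> 'm functional set) \<Rightarrow>
     'b field \<Rightarrow> 'm field" where
  "hlift_field B p H A = (\<lambda>x. hlift B p H x (A (p x)))"


section \<open>2-connections\<close>

definition linear_between :: "'v::real_vector set \<Rightarrow> 'w::real_vector set \<Rightarrow> ('v \<Rightarrow> 'w) \<Rightarrow> bool" where
  "linear_between V W \<phi> \<longleftrightarrow> \<phi> ` V \<subseteq> W \<and>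
     (\<forall>u\<in>V. \<forall>v\<in>V. \<phi> (u + v) = \<phi> u + \<phi> v) \<and> (\<forall>c. \<forall>v\<in>V. \<phi> (c *\<^sub>R v) = c *\<^sub>R \<phi> v)"

text \<open>
  The compatibility of a Schwartz morphism \<open>\<phi>\<close> with the symbol: if \<open>q(l)\<close> is the sum of the tensors
  \<open>u i \<otimes> v i\<close>, then \<open>q(\<phi> l)\<close> is the sum of the tensors \<open>\<phi> (u i) \<otimes> \<phi> (v i)\<close>. The tensor \<open>u \<otimes> v\<close> is
  represented by the bilinear form with value \<open>u f * v g\<close> on the differentials of \<open>f\<close> and \<open>g\<close>.
\<close>

definition schwartz_morphism ::
    "('b, 'c::euclidean_space) atlas \<Rightarrow> 'b \<Rightarrow> ('m, 'e::euclidean_space) atlas \<Rightarrow> 'm \<Rightarrow>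
     ('b functional \<Rightarrow> 'm functional) \<Rightarrow> bool" where
  "schwartz_morphism B b M x \<phi> \<longleftrightarrow>
     linear_between (tangent2_space B b) (tangent2_space M x) \<phi> \<and>
     \<phi> ` tangent_space B b \<subseteq> tangent_space M x \<and>
     (\<forall>l\<in>tangent2_space B b. \<forall>N (u :: nat \<Rightarrow> _) v.
        (\<forall>i<N. u i \<in> tangent_space B b \<and> v i \<in> tangent_space B b) \<longrightarrow>
        (\<forall>f\<in>smooth_fun B. \<forall>g\<in>smooth_fun B. symbol b l f g = (\<Sum>i<N. u i f * v i g)) \<longrightarrow>
        (\<forall>f\<in>smooth_fun M. \<forall>g\<in>smooth_fun M.
           symbol x (\<phi> l) f g = (\<Sum>i<N. \<phi> (u i) f * \<phi> (v i) g)))"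

text \<open>
  A bundle map from the pull-back of the second order tangent bundle of \<open>B\<close> is smooth iff it maps
  the pull-backs of smooth sections to smooth sections.
\<close>

definition two_connection ::
    "('m, 'e::euclidean_space) atlas \<Rightarrow> ('b, 'c::euclidean_space) atlas \<Rightarrow> ('m \<Rightarrow> 'b) \<Rightarrow>
     ('m \<Rightarrow> 'b functional \<Rightarrow> 'm functional) \<Rightarrow> bool" where
  "two_connection M B p hS \<longleftrightarrow>
     (\<forall>x. schwartz_morphism B (p x) M x (hS x)) \<and>
     (\<forall>x. \<forall>l\<in>tangent2_space B (p x). push B p (hS x l) = l) \<and>
     (\<forall>L\<in>operators2 B. (\<lambda>x. hS x (L (p x))) \<in> operators2 M)"

definition induced_two_connection ::
    "('m, 'e::euclidean_space) atlas \<Rightarrow> ('b, 'c::euclidean_space) atlas \<Rightarrow> ('m \<Rightarrow> 'b) \<Rightarrow>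
     ('m \<Rightarrow> 'm functional set) \<Rightarrow> ('m \<Rightarrow> 'b functional \<Rightarrow> 'm functional) \<Rightarrow> bool" where
  "induced_two_connection M B p H hS \<longleftrightarrow>
     two_connection M B p hS \<and>
     (\<forall>x. \<forall>u\<in>tangent_space B (p x). hS x u = hlift B p H x u) \<and>
     (\<forall>A\<in>vector_fields B. \<forall>Z\<in>vector_fields B. \<forall>x.
        hS x (anticommutator A Z (p x)) =
        anticommutator (hlift_field B p H A) (hlift_field B p H Z) x)"


section \<open>Riemannian metrics and Laplacians\<close>

type_synonym 'm metric = "'m \<Rightarrow> 'm functional \<Rightarrow> 'm functional \<Rightarrow> real"

definition riemannian_metric :: "('m, 'e::euclidean_space) atlas \<Rightarrow> 'm metric \<Rightarrow> bool" where
  "riemannian_metric M g \<longleftrightarrow>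
     (\<forall>x. \<forall>u\<in>tangent_space M x. \<forall>v\<in>tangent_space M x. g x u v = g x v u) \<and>
     (\<forall>x. \<forall>w\<in>tangent_space M x. linear_between (tangent_space M x) UNIV (\<lambda>u. g x u w)) \<and>
     (\<forall>x. \<forall>v\<in>tangent_space M x. v \<noteq> 0 \<longrightarrow> 0 < g x v v) \<and>
     (\<forall>X\<in>vector_fields M. \<forall>Y\<in>vector_fields M. (\<lambda>x. g x (X x) (Y x)) \<in> smooth_fun M)"

type_synonym 'm connection = "'m field \<Rightarrow> 'm field \<Rightarrow> 'm field"

definition affine_connection :: "('m, 'e::euclidean_space) atlas \<Rightarrow> 'm connection \<Rightarrow> bool" where
  "affine_connection M nab \<longleftrightarrow>
     (\<forall>X\<in>vector_fields M. \<forall>Y\<in>vector_fields M. nab X Y \<in> vector_fields M) \<and>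
     (\<forall>X\<in>vector_fields M. \<forall>Y\<in>vector_fields M. \<forall>Z\<in>vector_fields M.
        nab (X + Y) Z = nab X Z + nab Y Z \<and> nab X (Y + Z) = nab X Y + nab X Z) \<and>
     (\<forall>X\<in>vector_fields M. \<forall>Y\<in>vector_fields M. \<forall>f\<in>smooth_fun M.
        nab (fun_scale f X) Y = fun_scale f (nab X Y) \<and>
        nab X (fun_scale f Y) = fun_scale (\<lambda>x. X x f) Y + fun_scale f (nab X Y))"

definition levi_civita :: "('m, 'e::euclidean_space) atlas \<Rightarrow> 'm metric \<Rightarrow> 'm connection \<Rightarrow> bool" where
  "levi_civita M g nab \<longleftrightarrow> affine_connection M nab \<and>
     (\<forall>X\<in>vector_fields M. \<forall>Y\<in>vector_fields M. nab X Y - nab Y X = bracket X Y) \<and>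
     (\<forall>X\<in>vector_fields M. \<forall>Y\<in>vector_fields M. \<forall>Z\<in>vector_fields M. \<forall>x.
        X x (\<lambda>y. g y (Y y) (Z y)) = g x (nab X Y x) (Z x) + g x (Y x) (nab X Z x))"

definition second_covariant :: "'m connection \<Rightarrow> 'm field \<Rightarrow> 'm field \<Rightarrow> 'm field" where
  "second_covariant nab A Z = compose_fields A Z - nab A Z"

definition local_orthonormal_basis ::
    "('m::topological_space, 'e::euclidean_space) atlas \<Rightarrow> ('m \<Rightarrow> 'm functional set) \<Rightarrow> 'm metric \<Rightarrow>
     'm set \<Rightarrow> nat \<Rightarrow> (nat \<Rightarrow> 'm field) \<Rightarrow> bool" where
  "local_orthonormal_basis M H h U n A \<longleftrightarrow> open U \<and>
     (\<forall>i<n. A i \<in> vector_fields M) \<and>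
     (\<forall>y\<in>U. (\<forall>i<n. \<forall>j<n. h y (A i y) (A j y) = (if i = j then 1 else 0)) \<and>
            span ((\<lambda>i. A i y) ` {..<n}) = H y)"

text \<open>
  \<open>D\<close> is the trace over \<open>H\<close>, with respect to the inner products \<open>h\<close> on \<open>H\<close>, of the second covariant
  derivative on functions.
\<close>

definition is_trace_operator ::
    "('m::topological_space, 'e::euclidean_space) atlas \<Rightarrow> ('m \<Rightarrow> 'm functional set) \<Rightarrow> 'm metric \<Rightarrow>
     'm connection \<Rightarrow> 'm field \<Rightarrow> bool" where
  "is_trace_operator M H h nab D \<longleftrightarrow>
     (\<forall>x. \<exists>U n A. x \<in> U \<and> local_orthonormal_basis M H h U n A \<and>
        (\<forall>y\<in>U. D y = (\<Sum>i<n. second_covariant nab (A i) (A i) y)))"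

definition is_laplacian ::
    "('m::topological_space, 'e::euclidean_space) atlas \<Rightarrow> 'm metric \<Rightarrow> 'm field \<Rightarrow> bool" where
  "is_laplacian M g D \<longleftrightarrow>
     (\<exists>nab. levi_civita M g nab \<and> is_trace_operator M (tangent_space M) g nab D)"

definition adapted_connection ::
    "('m \<Rightarrow> 'm functional set) \<Rightarrow> ('m \<Rightarrow> 'm functional set) \<Rightarrow> 'm connection \<Rightarrow> 'm connection" where
  "adapted_connection H V nab A Z =
     pr H V (nab (pr H V A) (pr H V Z)) + pr V H (nab (pr V H A) (pr V H Z)) +
     pr H V (bracket (pr V H A) (pr H V Z)) + pr V H (bracket (pr H V A) (pr V H Z))"

text \<open>
  The operator does not depend on the choice of the metric \<open>g\<close>, so \<open>D\<close> is determined by \<open>H\<close>, \<open>V\<close>, \<open>h\<close>.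
\<close>

definition is_sub_laplacian ::
    "('m::topological_space, 'e::euclidean_space) atlas \<Rightarrow> ('m \<Rightarrow> 'm functional set) \<Rightarrow> 'm metric \<Rightarrow>
     ('m \<Rightarrow> 'm functional set) \<Rightarrow> 'm field \<Rightarrow> bool" where
  "is_sub_laplacian M H h V D \<longleftrightarrow>
     (\<exists>g nab. riemannian_metric M g \<and>
        (\<forall>x. \<forall>u\<in>H x. \<forall>v\<in>H x. g x u v = h x u v) \<and>
        (\<forall>x. {w \<in> tangent_space M x. \<forall>u\<in>H x. g x u w = 0} = V x) \<and>
        levi_civita M g nab \<and>
        is_trace_operator M H h (adapted_connection H V nab) D)"

definition pullback_metric ::
    "('b, 'c::euclidean_space) atlas \<Rightarrow> ('m \<Rightarrow> 'b) \<Rightarrow> 'b metric \<Rightarrow> 'm metric" where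
  "pullback_metric B p g = (\<lambda>x u v. g (p x) (push B p u) (push B p v))"

end

theory Submission
  imports Defs "HOL-Real_Asymp.Real_Asymp"
begin

text \<open>
  For a local orthonormal frame \<open>A i\<close> of \<open>B\<close>, the horizontal lifts \<open>hA i\<close> are a local orthonormal
  frame of \<open>H\<close>. Since \<open>h\<^sup>S\<close> respects anticommutators, it maps the sum of
  \<open>A i A i - \<nabla> (A i) (A i)\<close> to the sum of \<open>hA i hA i - h (\<nabla> (A i) (A i))\<close>. On the other hand, the
  Koszul formula shows that \<open>h (\<nabla> (A i) (A i))\<close> is the horizontal part of the Levi-Civita derivative
  on \<open>M\<close>, which is all that remains of the adapted connection on horizontal fields. The trace
  defining the sub-Laplacian may be computed in the frame \<open>hA i\<close> because the second covariant
  derivative of an affine connection is tensorial; that the values of the given frames away from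
  the point do not matter is where smooth bump functions enter.
\<close>

section \<open>Smooth functions\<close>

text \<open>Two facts make the comparison of \<open>M\<close> and \<open>B\<close> possible: a
  horizontal vector is determined by its push-forward, and \<open>g\<close> paired with a horizontal
  vector sees only push-forwards, because the vertical space is the \<open>g\<close>-orthogonal
  complement of \<open>H\<close>. The free choice of \<open>g\<close> on vertical vectors therefore
  never shows in a product with a lift. Tensoriality holds because \<open>A Z\<close> and the
  derivative of \<open>Z\<close> along \<open>A\<close> have the same Leibniz defect
  \<open>(A f) Z\<close>. It needs the adapted connection to be affine, hence projection to
  \<open>H\<close> to preserve smoothness. That is read off from an expansion in lifted frames: the
  lifts are smooth since \<open>hS\<close> extends the lift and preserves smooth sections, and the
  frames on \<open>B\<close> come with the trace that defines its Laplacian. The frame in the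
  sub-Laplacian is unrelated to the lifted one. Their mutual \<open>g\<close>-products are the
  transition coefficients; at the point in question these have orthonormal columns, which is what a
  trace requires.\<close>

lemma Ck_on_cong:
  assumes "Ck_on k W f" "open W" "\<And>x. x \<in> W \<Longrightarrow> f x = g x"
  shows "Ck_on k W g"
  using assms
proof (induction k arbitrary: f g)
  case 0
  then show ?case using continuous_on_cong by force
next
  case (Suc k)
  have d: "f differentiable (at x)" if "x \<in> W" for x
    using Suc.prems(1) that by simp
  have g: "g differentiable (at x)" if "x \<in> W" for x
    using d[OF that] Suc.prems that unfolding differentiable_def
    by (meson has_derivative_transform_within_open)
  have "Ck_on k W (\<lambda>x. frechet_derivative g (at x) v)" for v
  proof (rule Suc.IH)
    show "Ck_on k W (\<lambda>x. frechet_derivative f (at x) v)"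
      using Suc.prems(1) by simp
    show "frechet_derivative f (at x) v = frechet_derivative g (at x) v" if "x \<in> W" for x
      using frechet_derivative_transform_within_open[OF d[OF that] Suc.prems(2) that Suc.prems(3)]
      by simp
  qed (rule Suc.prems(2))
  with g show ?case by simp
qed

lemma Ck_on_subset: "Ck_on k W f \<Longrightarrow> V \<subseteq> W \<Longrightarrow> Ck_on k V f"
  by (induction k arbitrary: f) (auto intro: continuous_on_subset)

lemma Ck_on_SucD: "Ck_on (Suc k) W f \<Longrightarrow> Ck_on k W f"
proof (induction k arbitrary: f)
  case 0
  then show ?case
    by (auto intro!: continuous_at_imp_continuous_on differentiable_imp_continuous_within)
next
  case (Suc k)
  then show ?case by (metis Ck_on.simps(2))
qed

lemma Ck_on_const: "Ck_on k W (\<lambda>_. c)"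
  by (induction k arbitrary: c) auto

lemma Ck_on_add:
  assumes "Ck_on k W f" "Ck_on k W g" "open W"
  shows "Ck_on k W (\<lambda>x. f x + g x)"
  using assms
proof (induction k arbitrary: f g)
  case 0
  then show ?case by (auto intro: continuous_intros)
next
  case (Suc k)
  have D: "((\<lambda>x. f x + g x) has_derivative
      (\<lambda>v. frechet_derivative f (at x) v + frechet_derivative g (at x) v)) (at x)" if "x \<in> W" for x
    using Suc.prems that by (auto intro!: has_derivative_add simp: frechet_derivative_works[symmetric])
  \<comment> \<open>The formula for the derivative is available only at points of \<open>W\<close>,
    so it is exchanged by \<open>Ck_on_cong\<close> and not by an equation between
    functions.\<close>
  have "Ck_on k W (\<lambda>x. frechet_derivative (\<lambda>x. f x + g x) (at x) v)" for v
  proof (rule Ck_on_cong)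
    show "Ck_on k W (\<lambda>x. frechet_derivative f (at x) v + frechet_derivative g (at x) v)"
      using Suc by auto
    show "frechet_derivative f (at x) v + frechet_derivative g (at x) v =
          frechet_derivative (\<lambda>x. f x + g x) (at x) v" if "x \<in> W" for x
      using frechet_derivative_at[OF D[OF that]] by metis
  qed (rule Suc.prems)
  moreover have "(\<lambda>x. f x + g x) differentiable (at x)" if "x \<in> W" for x
    using D[OF that] by (auto simp: differentiable_def)
  ultimately show ?case by simp
qed

text \<open>General \<open>b\<close>, so that one product rule serves both real products and the
  inner product in the bump function.\<close>

lemma Ck_on_bilinear:
  assumes "bounded_bilinear b" "Ck_on k W f" "Ck_on k W g" "open W"
  shows "Ck_on k W (\<lambda>x. b (f x) (g x))"
  using assms(2-4)
proof (induction k arbitrary: f g)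
  case 0
  then show ?case using bounded_bilinear.continuous_on[OF assms(1)] by auto
next
  case (Suc k)
  have D: "((\<lambda>x. b (f x) (g x)) has_derivative
      (\<lambda>v. b (f x) (frechet_derivative g (at x) v) + b (frechet_derivative f (at x) v) (g x)))
      (at x)" if "x \<in> W" for x
    using Suc.prems that
    by (auto intro!: bounded_bilinear.FDERIV[OF assms(1)] simp: frechet_derivative_works[symmetric])
  have "Ck_on k W (\<lambda>x. frechet_derivative (\<lambda>x. b (f x) (g x)) (at x) v)" for v
  proof (rule Ck_on_cong)
    show "Ck_on k W (\<lambda>x. b (f x) (frechet_derivative g (at x) v) +
                         b (frechet_derivative f (at x) v) (g x))"
      using Suc Ck_on_SucD[OF Suc.prems(1)] Ck_on_SucD[OF Suc.prems(2)]
      by (intro Ck_on_add Suc.IH) auto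
    show "b (f x) (frechet_derivative g (at x) v) + b (frechet_derivative f (at x) v) (g x) =
          frechet_derivative (\<lambda>x. b (f x) (g x)) (at x) v" if "x \<in> W" for x
      using frechet_derivative_at[OF D[OF that]] by metis
  qed (rule Suc.prems)
  moreover have "(\<lambda>x. b (f x) (g x)) differentiable (at x)" if "x \<in> W" for x
    using D[OF that] by (auto simp: differentiable_def)
  ultimately show ?case by simp
qed

text \<open>The chain rule replaces \<open>h\<close> by its derivative. Assuming all orders for
  \<open>h\<close> keeps the hypothesis stable under this replacement, while \<open>q\<close> only
  loses one order.\<close>

lemma Ck_on_compose_real:
  fixes h :: "real \<Rightarrow> real"
  assumes "\<And>k. Ck_on k UNIV h" "Ck_on k W q" "open W"
  shows "Ck_on k W (\<lambda>x. h (q x))"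
  using assms
proof (induction k arbitrary: h)
  case 0
  then have "continuous_on UNIV h" "continuous_on W q" by (metis Ck_on.simps(1))+
  then show ?case by (auto intro: continuous_on_compose2)
next
  case (Suc k)
  \<comment> \<open>A linear map on the reals is multiplication by its value at 1, so the derivative
    of \<open>h\<close> becomes a real function to which the induction hypothesis applies.\<close>
  let ?h' = "\<lambda>t. frechet_derivative h (at t) 1"
  have h: "h differentiable (at t)" and h': "Ck_on j UNIV ?h'" for t j
    using Suc.prems(1)[of "Suc j"] by auto
  have "frechet_derivative h (at t) s = ?h' t * s" for s t
    using linear_scale[OF linear_frechet_derivative[OF h], of t s 1] by simp
  then have h_deriv: "(h has_derivative (\<lambda>s. ?h' t * s)) (at t)" for t
    using h[of t] unfolding frechet_derivative_works by (metis (no_types, lifting) ext)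
  have D: "((\<lambda>x. h (q x)) has_derivative (\<lambda>v. ?h' (q x) * frechet_derivative q (at x) v)) (at x)"
    if "x \<in> W" for x
  proof -
    have "(q has_derivative frechet_derivative q (at x)) (at x)"
      using Suc.prems(2) that by (simp add: frechet_derivative_works[symmetric])
    then show ?thesis by (rule has_derivative_compose[OF _ h_deriv])
  qed
  have "Ck_on k W (\<lambda>x. frechet_derivative (\<lambda>x. h (q x)) (at x) v)" for v
  proof (rule Ck_on_cong)
    have "Ck_on k W (\<lambda>x. ?h' (q x))"
      by (rule Suc.IH[OF h' Ck_on_SucD[OF Suc.prems(2)] Suc.prems(3)])
    then show "Ck_on k W (\<lambda>x. ?h' (q x) * frechet_derivative q (at x) v)"
      using Suc.prems by (intro Ck_on_bilinear[OF bounded_bilinear_mult]) auto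
    show "?h' (q x) * frechet_derivative q (at x) v =
          frechet_derivative (\<lambda>x. h (q x)) (at x) v" if "x \<in> W" for x
      using frechet_derivative_at[OF D[OF that]] by metis
  qed (rule Suc.prems)
  moreover have "(\<lambda>x. h (q x)) differentiable (at x)" if "x \<in> W" for x
    using D[OF that] by (auto simp: differentiable_def)
  ultimately show ?case by simp
qed

text \<open>
  The powers of \<open>1 / t\<close> make the family closed under differentiation; for \<open>m = 0\<close> this is the
  standard smooth function that vanishes exactly on the non-positive numbers.
\<close>

definition flat :: "nat \<Rightarrow> real \<Rightarrow> real" where
  "flat m t = (if t \<le> 0 then 0 else exp (- (1 / t)) / t ^ m)"

lemma flat_has_derivative:
  "(flat m has_real_derivative flat (m + 2) t - m * flat (m + 1) t) (at t)"
proof -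
  consider "t < 0" | "t = 0" | "t > 0" by linarith
  then show ?thesis
  proof cases
    case 1
    have "((\<lambda>_. 0) has_real_derivative 0) (at t)" by simp
    then have "(flat m has_real_derivative 0) (at t)"
      by (rule has_field_derivative_transform_within_open[where S = "{..<0}"])
         (use 1 in \<open>auto simp: flat_def\<close>)
    then show ?thesis using 1 by (simp add: flat_def)
  next
    \<comment> \<open>The only delicate point: from the right the difference quotient is
      \<open>exp (- (1 / h)) / h ^ (m + 1)\<close>, and the exponential beats every power.\<close>
    case 2
    have "((\<lambda>h. flat m h / h) \<longlongrightarrow> 0) (at_left 0)"
    proof (rule Lim_transform_eventually)
      show "\<forall>\<^sub>F h in at_left 0. 0 = flat m h / h"
        by (simp add: eventually_at_filter flat_def)
    qed simp
    moreover have "((\<lambda>h. flat m h / h) \<longlongrightarrow> 0) (at_right 0)"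
    proof (rule Lim_transform_eventually)
      show "((\<lambda>h::real. exp (- (1 / h)) / h ^ m / h) \<longlongrightarrow> 0) (at_right 0)"
        by real_asymp
      show "\<forall>\<^sub>F h in at_right 0. exp (- (1 / h)) / h ^ m / h = flat m h / h"
        by (simp add: eventually_at_filter flat_def)
    qed
    ultimately have "((\<lambda>h. flat m h / h) \<longlongrightarrow> 0) (at 0)"
      by (simp add: filterlim_split_at)
    then show ?thesis
      using 2 by (simp add: DERIV_def flat_def)
  next
    case 3
    have "((\<lambda>t. exp (- (1 / t)) / t ^ m) has_real_derivative
        exp (- (1 / t)) / t ^ (m + 2) - m * (exp (- (1 / t)) / t ^ (m + 1))) (at t)"
    proof -
      have "((\<lambda>t. t ^ m) has_real_derivative m * t ^ m / t) (at t)"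
        using DERIV_pow[of m t UNIV] 3 by (cases m) auto
      moreover have "((\<lambda>t. exp (- (1 / t))) has_real_derivative exp (- (1 / t)) / t\<^sup>2) (at t)"
        using 3 by (auto intro!: derivative_eq_intros simp: power2_eq_square)
      ultimately have "((\<lambda>t. exp (- (1 / t)) / t ^ m) has_real_derivative
          (exp (- (1 / t)) / t\<^sup>2 * t ^ m - exp (- (1 / t)) * (m * t ^ m / t)) / (t ^ m * t ^ m)) (at t)"
        using 3 by (intro DERIV_divide) auto
      then show ?thesis
        by (rule DERIV_cong) (use 3 in \<open>simp add: divide_simps power2_eq_square, simp add: algebra_simps\<close>)
    qed
    then have "(flat m has_real_derivative
        exp (- (1 / t)) / t ^ (m + 2) - m * (exp (- (1 / t)) / t ^ (m + 1))) (at t)"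
      by (rule has_field_derivative_transform_within_open[where S = "{0<..}"])
         (use 3 in \<open>auto simp: flat_def\<close>)
    then show ?thesis using 3 by (simp add: flat_def)
  qed
qed

lemma flat_smooth: "Ck_on k UNIV (flat m)"
proof (induction k arbitrary: m)
  case 0
  show ?case
    using DERIV_isCont[OF flat_has_derivative] by (auto intro: continuous_at_imp_continuous_on)
next
  case (Suc k)
  have D: "(flat m has_derivative (\<lambda>v. v * (flat (m + 2) t + (- real m) * flat (m + 1) t))) (at t)" for t
    using flat_has_derivative[of m t] unfolding has_field_derivative_def
    by (rule has_derivative_eq_rhs) (auto simp: mult.commute)
  have "Ck_on k UNIV (\<lambda>t. frechet_derivative (flat m) (at t) v)" for v
    unfolding frechet_derivative_at[OF D, symmetric]
    by (intro Ck_on_bilinear[OF bounded_bilinear_mult] Ck_on_add Ck_on_const Suc) auto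
  moreover have "flat m differentiable (at t)" for t
    using D by (auto simp: differentiable_def)
  ultimately show ?case by simp
qed

section \<open>Closure and locality of smoothness on arbitrary subsets\<close>

lemma smooth_on_const: "smooth_on X (\<lambda>_. c)"
  unfolding smooth_on_def by (intro ballI exI[of _ UNIV] exI[of _ "\<lambda>_. c"]) (auto simp: Ck_on_const)

lemma smooth_on_add:
  assumes "smooth_on X f" "smooth_on X g"
  shows "smooth_on X (\<lambda>y. f y + g y)"
  unfolding smooth_on_def
proof
  fix x assume x: "x \<in> X"
  obtain V F where F: "open V" "x \<in> V" "\<forall>k. Ck_on k V F" "\<forall>y\<in>X \<inter> V. F y = f y"
    using assms(1) x unfolding smooth_on_def by metis
  obtain W G where G: "open W" "x \<in> W" "\<forall>k. Ck_on k W G" "\<forall>y\<in>X \<inter> W. G y = g y"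
    using assms(2) x unfolding smooth_on_def by metis
  have "\<forall>k. Ck_on k (V \<inter> W) (\<lambda>y. F y + G y)"
    using F G by (auto intro!: Ck_on_add intro: Ck_on_subset)
  then show "\<exists>W H. open W \<and> x \<in> W \<and> (\<forall>k. Ck_on k W H) \<and> (\<forall>y\<in>X \<inter> W. H y = f y + g y)"
    using F G by (intro exI[of _ "V \<inter> W"] exI[of _ "\<lambda>y. F y + G y"]) auto
qed

lemma smooth_on_bilinear:
  assumes "bounded_bilinear b" "smooth_on X f" "smooth_on X g"
  shows "smooth_on X (\<lambda>y. b (f y) (g y))"
  unfolding smooth_on_def
proof
  fix x assume x: "x \<in> X"
  obtain V F where F: "open V" "x \<in> V" "\<forall>k. Ck_on k V F" "\<forall>y\<in>X \<inter> V. F y = f y"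
    using assms(2) x unfolding smooth_on_def by metis
  obtain W G where G: "open W" "x \<in> W" "\<forall>k. Ck_on k W G" "\<forall>y\<in>X \<inter> W. G y = g y"
    using assms(3) x unfolding smooth_on_def by metis
  have "\<forall>k. Ck_on k (V \<inter> W) (\<lambda>y. b (F y) (G y))"
    using F G by (auto intro!: Ck_on_bilinear[OF assms(1)] intro: Ck_on_subset)
  then show "\<exists>W H. open W \<and> x \<in> W \<and> (\<forall>k. Ck_on k W H) \<and> (\<forall>y\<in>X \<inter> W. H y = b (f y) (g y))"
    using F G by (intro exI[of _ "V \<inter> W"] exI[of _ "\<lambda>y. b (F y) (G y)"]) auto
qed

lemma smooth_on_compose_real:
  fixes h :: "real \<Rightarrow> real"
  assumes "\<And>k. Ck_on k UNIV h" "smooth_on X f"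
  shows "smooth_on X (\<lambda>y. h (f y))"
  unfolding smooth_on_def
proof
  fix x assume "x \<in> X"
  then obtain W F where F: "open W" "x \<in> W" "\<forall>k. Ck_on k W F" "\<forall>y\<in>X \<inter> W. F y = f y"
    using assms(2) unfolding smooth_on_def by metis
  then show "\<exists>W G. open W \<and> x \<in> W \<and> (\<forall>k. Ck_on k W G) \<and> (\<forall>y\<in>X \<inter> W. G y = h (f y))"
    by (intro exI[of _ W] exI[of _ "\<lambda>y. h (F y)"]) (auto intro: Ck_on_compose_real[OF assms(1)])
qed

lemma smooth_on_local:
  assumes "\<And>x. x \<in> X \<Longrightarrow> \<exists>W g. open W \<and> x \<in> W \<and> smooth_on (X \<inter> W) g \<and> (\<forall>y\<in>X \<inter> W. g y = f y)"
  shows "smooth_on X f"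
  unfolding smooth_on_def
proof
  fix x assume x: "x \<in> X"
  obtain W g where W: "open W" "x \<in> W" "smooth_on (X \<inter> W) g" "\<forall>y\<in>X \<inter> W. g y = f y"
    using assms[OF x] by blast
  then obtain V G where G: "open V" "x \<in> V" "\<forall>k. Ck_on k V G" "\<forall>y\<in>X \<inter> W \<inter> V. G y = g y"
    using x unfolding smooth_on_def by (metis IntI)
  then show "\<exists>W F. open W \<and> x \<in> W \<and> (\<forall>k. Ck_on k W F) \<and> (\<forall>y\<in>X \<inter> W. F y = f y)"
    using W by (intro exI[of _ "V \<inter> W"] exI[of _ G]) (auto intro: Ck_on_subset)
qed

lemma smooth_on_subset:
  assumes "smooth_on X f" "Y \<subseteq> X"
  shows "smooth_on Y f"
  unfolding smooth_on_def
proof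
  fix x assume "x \<in> Y"
  with assms(2) have "x \<in> X" ..
  then obtain W F where "open W" "x \<in> W" "\<forall>k. Ck_on k W F" "\<forall>y\<in>X \<inter> W. F y = f y"
    using assms(1) unfolding smooth_on_def by metis
  then show "\<exists>W F. open W \<and> x \<in> W \<and> (\<forall>k. Ck_on k W F) \<and> (\<forall>y\<in>Y \<inter> W. F y = f y)"
    using assms(2) by (intro exI[of _ W] exI[of _ F]) auto
qed

section \<open>Smooth functions on a manifold and bump functions\<close>

lemma smooth_fun_const: "(\<lambda>_. c) \<in> smooth_fun M"
  by (auto simp: smooth_fun_def smooth_on_const)

lemma smooth_fun_add: "f \<in> smooth_fun M \<Longrightarrow> g \<in> smooth_fun M \<Longrightarrow> (\<lambda>x. f x + g x) \<in> smooth_fun M"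
  by (auto simp: smooth_fun_def intro!: smooth_on_add)

lemma smooth_fun_mult: "f \<in> smooth_fun M \<Longrightarrow> g \<in> smooth_fun M \<Longrightarrow> (\<lambda>x. f x * g x) \<in> smooth_fun M"
  by (auto simp: smooth_fun_def intro!: smooth_on_bilinear[OF bounded_bilinear_mult])

lemma smooth_fun_diff: "f \<in> smooth_fun M \<Longrightarrow> g \<in> smooth_fun M \<Longrightarrow> (\<lambda>x. f x - g x) \<in> smooth_fun M"
  using smooth_fun_add[of f M "\<lambda>x. -1 * g x"] smooth_fun_mult[OF smooth_fun_const, of g M "-1"] by simp

lemma smooth_fun_sum:
  "(\<And>i. i \<in> I \<Longrightarrow> f i \<in> smooth_fun M) \<Longrightarrow> (\<lambda>x. \<Sum>i\<in>I. f i x) \<in> smooth_fun M"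
  by (induction I rule: infinite_finite_induct) (auto intro!: smooth_fun_add simp: smooth_fun_const)

lemma smooth_atlas_chart:
  assumes "smooth_atlas M"
  obtains S where "subspace S"
    "\<And>V \<psi>. (V, \<psi>) \<in> M \<Longrightarrow> open V \<and> \<psi> ` V \<subseteq> S \<and> openin (top_of_set S) (\<psi> ` V) \<and>
                      homeomorphism V (\<psi> ` V) \<psi> (inv_into V \<psi>)"
proof -
  obtain S where S: "subspace S"
    and c: "\<forall>(V, \<psi>)\<in>M. open V \<and> \<psi> ` V \<subseteq> S \<and> openin (top_of_set S) (\<psi> ` V) \<and>
                      homeomorphism V (\<psi> ` V) \<psi> (inv_into V \<psi>)"
    using assms unfolding smooth_atlas_def by (elim conjE exE)
  show thesis using S c[rule_format] by (intro that[of S]) auto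
qed

lemma smooth_atlas_transition:
  assumes "smooth_atlas M" "(U, \<phi>) \<in> M" "(V, \<psi>) \<in> M"
  shows "smooth_on (\<phi> ` (U \<inter> V)) (\<lambda>y. \<psi> (inv_into U \<phi> y))"
proof -
  have "\<forall>(U, \<phi>)\<in>M. \<forall>(V, \<psi>)\<in>M. smooth_on (\<phi> ` (U \<inter> V)) (\<lambda>y. \<psi> (inv_into U \<phi> y))"
    using assms(1) unfolding smooth_atlas_def by (elim conjE)
  from bspec[OF this assms(2)] have "\<forall>(V, \<psi>)\<in>M. smooth_on (\<phi> ` (U \<inter> V)) (\<lambda>y. \<psi> (inv_into U \<phi> y))"
    by simp
  from bspec[OF this assms(3)] show ?thesis by simp
qed

text \<open>Charts are homeomorphisms, so \<open>V \<inter> N\<close> has a relatively open image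
  and \<open>smooth_on_local\<close> applies there. The local model \<open>g\<close> has to be
  smooth only in the chart at hand and on \<open>N\<close>, which permits gluing from pieces that
  make sense in a single chart only.\<close>

lemma smooth_funI_local:
  assumes M: "smooth_atlas M"
    and loc: "\<And>V \<psi> z. (V, \<psi>) \<in> M \<Longrightarrow> z \<in> V \<Longrightarrow>
      \<exists>N g. open N \<and> z \<in> N \<and> smooth_on (\<psi> ` (V \<inter> N)) (\<lambda>y. g (inv_into V \<psi> y)) \<and> (\<forall>y\<in>N. g y = f y)"
  shows "f \<in> smooth_fun M"
proof -
  have "smooth_on (\<psi> ` V) (\<lambda>y. f (inv_into V \<psi> y))" if V: "(V, \<psi>) \<in> M" for V \<psi>
  proof (rule smooth_on_local)
    fix y assume "y \<in> \<psi> ` V"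
    then obtain z where z: "z \<in> V" "y = \<psi> z" by blast
    obtain N g where N: "open N" "z \<in> N" "smooth_on (\<psi> ` (V \<inter> N)) (\<lambda>y. g (inv_into V \<psi> y))"
      "\<forall>y\<in>N. g y = f y"
      using loc[OF V z(1)] by blast
    have hom: "homeomorphism V (\<psi> ` V) \<psi> (inv_into V \<psi>)"
      using smooth_atlas_chart[OF M] V by metis
    have "openin (top_of_set (\<psi> ` V)) (\<psi> ` (V \<inter> N))"
      by (rule homeomorphism_imp_open_map[OF hom]) (use N(1) in \<open>auto simp: openin_open\<close>)
    then obtain W where W: "open W" "\<psi> ` (V \<inter> N) = \<psi> ` V \<inter> W"
      by (auto simp: openin_open)
    have "g (inv_into V \<psi> u) = f (inv_into V \<psi> u)" if "u \<in> \<psi> ` (V \<inter> N)" for u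
      using that N(4) homeomorphism_apply1[OF hom] by auto
    then show "\<exists>W g. open W \<and> y \<in> W \<and> smooth_on (\<psi> ` V \<inter> W) g \<and>
        (\<forall>u\<in>\<psi> ` V \<inter> W. g u = f (inv_into V \<psi> u))"
      using W N(2,3) z by (intro exI[of _ W] exI[of _ "\<lambda>y. g (inv_into V \<psi> y)"]) auto
  qed
  then show ?thesis by (auto simp: smooth_fun_def)
qed

lemma smooth_fun_local:
  assumes "smooth_atlas M"
    and "\<And>x. \<exists>N g. open N \<and> x \<in> N \<and> g \<in> smooth_fun M \<and> (\<forall>y\<in>N. g y = f y)"
  shows "f \<in> smooth_fun M"
proof (rule smooth_funI_local[OF assms(1)])
  fix V \<psi> z assume V: "(V, \<psi>) \<in> M"
  obtain N g where "open N" "z \<in> N" "g \<in> smooth_fun M" "\<forall>y\<in>N. g y = f y"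
    using assms(2) by blast
  moreover from this(3) V have "smooth_on (\<psi> ` V) (\<lambda>y. g (inv_into V \<psi> y))"
    by (auto simp: smooth_fun_def)
  then have "smooth_on (\<psi> ` (V \<inter> N)) (\<lambda>y. g (inv_into V \<psi> y))"
    by (rule smooth_on_subset) auto
  ultimately show "\<exists>N g. open N \<and> z \<in> N \<and> smooth_on (\<psi> ` (V \<inter> N)) (\<lambda>y. g (inv_into V \<psi> y)) \<and>
      (\<forall>y\<in>N. g y = f y)" by blast
qed

text \<open>One minus a normalised bump function. In this form, a field that vanishes on
  \<open>U\<close> equals its own multiple by the function, and the multiple is killed at
  \<open>x\<close> by any function-linear expression.\<close>

lemma smooth_bump:
  fixes M :: "('m::{t2_space, second_countable_topology}, 'e::euclidean_space) atlas"
  assumes M: "smooth_atlas M" and U: "open U" "x \<in> U"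
  obtains \<phi> where "\<phi> \<in> smooth_fun M" "\<phi> x = 0" "\<And>y. y \<notin> U \<Longrightarrow> \<phi> y = 1"
proof -
  obtain V \<psi> where V: "(V, \<psi>) \<in> M" "x \<in> V"
  proof -
    have "(\<Union>(V, \<psi>)\<in>M. V) = UNIV" using M unfolding smooth_atlas_def by (elim conjE)
    then have "x \<in> (\<Union>(V, \<psi>)\<in>M. V)" by simp
    then show thesis using that by auto
  qed
  obtain S where S: "subspace S" "open V" "\<psi> ` V \<subseteq> S" "openin (top_of_set S) (\<psi> ` V)"
      and hom: "homeomorphism V (\<psi> ` V) \<psi> (inv_into V \<psi>)"
    using smooth_atlas_chart[OF M] V(1) by metis
  have "openin (top_of_set (\<psi> ` V)) (\<psi> ` (V \<inter> U))"
    by (rule homeomorphism_imp_open_map[OF hom]) (use U(1) in \<open>auto simp: openin_open\<close>)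
  then have "openin (top_of_set S) (\<psi> ` (V \<inter> U))"
    using S(4) openin_trans by blast
  then obtain W where W: "open W" "\<psi> ` (V \<inter> U) = S \<inter> W"
    by (auto simp: openin_open)
  have "\<psi> x \<in> W" using W(2) U(2) V(2) by blast
  then obtain r where r: "r > 0" "cball (\<psi> x) r \<subseteq> W"
    using W(1) open_contains_cball by blast
  \<comment> \<open>Compact because the subspace \<open>S\<close> is closed, and inside the chart
    image by the choice of \<open>W\<close>.\<close>
  let ?C = "cball (\<psi> x) r \<inter> S"
  have C: "?C \<subseteq> \<psi> ` (V \<inter> U)" using r(2) W(2) by blast
  \<comment> \<open>Compact, hence closed in the Hausdorff space; its complement will be the open
    set on which the extension by zero is smooth.\<close>
  define K where "K = inv_into V \<psi> ` ?C"
  have "compact ?C"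
    using closed_subspace[OF S(1)] by (intro compact_Int_closed) auto
  moreover have "continuous_on ?C (inv_into V \<psi>)"
    by (rule continuous_on_subset[OF homeomorphism_cont2[OF hom]]) (use C in blast)
  ultimately have "closed K"
    unfolding K_def by (intro compact_imp_closed compact_continuous_image)
  have KU: "K \<subseteq> U"
    using C homeomorphism_apply1[OF hom] unfolding K_def by fastforce
  \<comment> \<open>The argument of \<open>flat 0\<close> is positive exactly when the chart image
    of \<open>z\<close> lies in the open ball of radius \<open>r\<close>. It is written as a sum
    with factor \<open>- 1\<close> to match the closure rules for \<open>smooth_on\<close>.\<close>
  define q where "q = (\<lambda>z. flat 0 (r\<^sup>2 + - 1 * ((\<psi> z - \<psi> x) \<bullet> (\<psi> z - \<psi> x))))"
  define b where "b = (\<lambda>z. if z \<in> V then q z else 0)"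
  have b0: "b z = 0" if "z \<notin> K" for z
  proof (cases "z \<in> V")
    case True
    then have "\<psi> z \<in> S" using S(3) by blast
    moreover have "z = inv_into V \<psi> (\<psi> z)" using homeomorphism_apply1[OF hom True] by simp
    ultimately have "\<psi> z \<notin> cball (\<psi> x) r" using that unfolding K_def by blast
    then have "r < norm (\<psi> z - \<psi> x)" by (simp add: dist_norm norm_minus_commute)
    then have "r\<^sup>2 < (\<psi> z - \<psi> x) \<bullet> (\<psi> z - \<psi> x)"
      using r(1) by (simp add: power2_norm_eq_inner[symmetric] power_strict_mono)
    then show ?thesis by (simp add: b_def q_def flat_def)
  qed (simp add: b_def)
  have "b \<in> smooth_fun M"
  proof (rule smooth_funI_local[OF M])
    fix V' \<psi>' z assume V': "(V', \<psi>') \<in> M" "z \<in> V'"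
    show "\<exists>N g. open N \<and> z \<in> N \<and> smooth_on (\<psi>' ` (V' \<inter> N)) (\<lambda>y. g (inv_into V' \<psi>' y)) \<and>
        (\<forall>y\<in>N. g y = b y)"
    proof (cases "z \<in> V")
      case True
      have "smooth_on (\<psi>' ` (V' \<inter> V)) (\<lambda>y. \<psi> (inv_into V' \<psi>' y))"
        by (rule smooth_atlas_transition[OF M V'(1) V(1)])
      then have "smooth_on (\<psi>' ` (V' \<inter> V)) (\<lambda>y. \<psi> (inv_into V' \<psi>' y) + - \<psi> x)"
        by (intro smooth_on_add smooth_on_const)
      then have "smooth_on (\<psi>' ` (V' \<inter> V)) (\<lambda>y. \<psi> (inv_into V' \<psi>' y) - \<psi> x)"
        by simp
      then have "smooth_on (\<psi>' ` (V' \<inter> V)) (\<lambda>y. q (inv_into V' \<psi>' y))"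
        unfolding q_def
        by (intro smooth_on_compose_real[where h = "flat 0"] flat_smooth smooth_on_add smooth_on_const
          smooth_on_bilinear[OF bounded_bilinear_mult] smooth_on_bilinear[OF bounded_bilinear_inner])
      then show ?thesis
        using True S(2) by (intro exI[of _ V] exI[of _ q]) (auto simp: b_def)
    next
      case False
      \<comment> \<open>\<open>K\<close> lies in \<open>V\<close>, so a point outside
        \<open>V\<close> has the neighbourhood \<open>- K\<close>, where \<open>b\<close>
        vanishes.\<close>
      have "z \<notin> K"
        using False C homeomorphism_apply1[OF hom] unfolding K_def by fastforce
      then show ?thesis
        using \<open>closed K\<close> b0 by (intro exI[of _ "- K"] exI[of _ "\<lambda>_. 0"]) (auto simp: smooth_on_const)
    qed
  qed
  \<comment> \<open>Division by \<open>b x\<close>, which is \<open>flat 0\<close> at the square of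
    \<open>r\<close> and thus positive, makes the value at \<open>x\<close> zero.\<close>
  then have "(\<lambda>y. 1 - (1 / b x) * b y) \<in> smooth_fun M"
    by (intro smooth_fun_diff smooth_fun_mult smooth_fun_const)
  moreover have "b x \<noteq> 0"
    using V(2) r(1) by (simp add: b_def q_def flat_def)
  ultimately show thesis
    using that[of "\<lambda>y. 1 - (1 / b x) * b y"] b0 KU by auto
qed

section \<open>Vector fields and connections\<close>

lemma sum_fun_apply: "(\<Sum>i\<in>I. F i) x = (\<Sum>i\<in>I. F i x)"
  by (induction I rule: infinite_finite_induct) auto

lemma subspace_functionals: "subspace (functionals M)"
  by (auto simp: subspace_def functionals_def scaleR_fun_def algebra_simps)

lemma subspace_tangent: "subspace (tangent_space M x)"
  using subspace_functionals[of M]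
  by (auto simp: subspace_def tangent_space_def scaleR_fun_def algebra_simps)

lemma subspace_tangent2: "subspace (tangent2_space M x)"
  using subspace_functionals[of M]
  by (auto simp: subspace_def tangent2_space_def scaleR_fun_def algebra_simps)

lemma functionals_add:
  "l \<in> functionals M \<Longrightarrow> f \<in> smooth_fun M \<Longrightarrow> g \<in> smooth_fun M \<Longrightarrow> l (\<lambda>y. f y + g y) = l f + l g"
  unfolding functionals_def plus_fun_def by blast

lemma functionals_cmult:
  "l \<in> functionals M \<Longrightarrow> f \<in> smooth_fun M \<Longrightarrow> l (\<lambda>y. c * f y) = c * l f"
  unfolding functionals_def scaleR_fun_def by simp

lemma functionals_zero: "l \<in> functionals M \<Longrightarrow> l (\<lambda>_. 0) = 0"
  using functionals_cmult[OF _ smooth_fun_const, of l M 0 0] by simp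

lemma functionals_nonsmooth: "l \<in> functionals M \<Longrightarrow> f \<notin> smooth_fun M \<Longrightarrow> l f = 0"
  unfolding functionals_def by blast

lemma tangent_functionals: "v \<in> tangent_space M x \<Longrightarrow> v \<in> functionals M"
  unfolding tangent_space_def by blast

lemma tangent_mult:
  "v \<in> tangent_space M x \<Longrightarrow> f \<in> smooth_fun M \<Longrightarrow> g \<in> smooth_fun M \<Longrightarrow>
     v (\<lambda>y. f y * g y) = f x * v g + g x * v f"
  unfolding tangent_space_def times_fun_def by blast

lemma tangent_one: "v \<in> tangent_space M x \<Longrightarrow> v (\<lambda>_. 1) = 0"
  using tangent_mult[OF _ smooth_fun_const smooth_fun_const, of v M x 1 1] by simp

text \<open>The Leibniz rule for the product of \<open>f * g\<close> with \<open>k\<close> leaves a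
  vanishing factor, \<open>f x\<close> or \<open>k x\<close>, in each term.\<close>

lemma tangent_subset_tangent2: "tangent_space M x \<subseteq> tangent2_space M x"
proof
  fix v assume v: "v \<in> tangent_space M x"
  have "v (f * g * k) = 0"
    if "f \<in> smooth_fun M" "g \<in> smooth_fun M" "k \<in> smooth_fun M" "f x = 0" "g x = 0" "k x = 0" for f g k
    using tangent_mult[OF v smooth_fun_mult[OF that(1,2)] that(3)] that(4,6)
    by (simp add: times_fun_def)
  then show "v \<in> tangent2_space M x"
    using tangent_functionals[OF v] tangent_one[OF v] by (simp add: tangent2_space_def)
qed

lemma vector_field_tangent: "X \<in> vector_fields M \<Longrightarrow> X x \<in> tangent_space M x"
  unfolding smooth_sections_def by blast

lemmas vector_field_functionals = tangent_functionals[OF vector_field_tangent]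

lemma vector_field_smooth:
  "X \<in> vector_fields M \<Longrightarrow> f \<in> smooth_fun M \<Longrightarrow> (\<lambda>x. X x f) \<in> smooth_fun M"
  unfolding smooth_sections_def by blast

lemma vector_field_nonsmooth: "X \<in> vector_fields M \<Longrightarrow> f \<notin> smooth_fun M \<Longrightarrow> X x f = 0"
  using functionals_nonsmooth[OF vector_field_functionals] .

lemma vector_field_zero: "0 \<in> vector_fields M"
  using subspace_0[OF subspace_tangent] smooth_fun_const[of 0 M]
  by (auto simp: smooth_sections_def zero_fun_def)

lemma vector_field_add: "X \<in> vector_fields M \<Longrightarrow> Y \<in> vector_fields M \<Longrightarrow> X + Y \<in> vector_fields M"
  by (auto simp: smooth_sections_def intro: subspace_add[OF subspace_tangent] smooth_fun_add)

lemma vector_field_diff: "X \<in> vector_fields M \<Longrightarrow> Y \<in> vector_fields M \<Longrightarrow> X - Y \<in> vector_fields M"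
  by (auto simp: smooth_sections_def intro: subspace_diff[OF subspace_tangent] smooth_fun_diff)

lemma fun_scale_apply [simp]: "fun_scale f X x = f x *\<^sub>R X x"
  by (simp add: fun_scale_def)

lemma scaleR_fun_apply [simp]: "(c *\<^sub>R f) x = c *\<^sub>R f x"
  by (simp add: scaleR_fun_def)

lemma vector_field_scale:
  "f \<in> smooth_fun M \<Longrightarrow> X \<in> vector_fields M \<Longrightarrow> fun_scale f X \<in> vector_fields M"
  by (auto simp: smooth_sections_def intro: subspace_scale[OF subspace_tangent] smooth_fun_mult)

lemma vector_field_sum:
  "(\<And>i. i \<in> I \<Longrightarrow> X i \<in> vector_fields M) \<Longrightarrow> (\<Sum>i\<in>I. X i) \<in> vector_fields M"
  by (induction I rule: infinite_finite_induct) (auto intro: vector_field_add vector_field_zero)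

section \<open>Composition and bracket of vector fields\<close>

lemma compose_fields_nonsmooth:
  assumes "X \<in> vector_fields M" "Y \<in> vector_fields M" "f \<notin> smooth_fun M"
  shows "compose_fields X Y x f = 0"
  using vector_field_nonsmooth[OF assms(2,3)] functionals_zero[OF vector_field_functionals[OF assms(1)]]
  by (simp add: compose_fields_def)

lemma compose_fields_functionals:
  assumes X: "X \<in> vector_fields M" and Y: "Y \<in> vector_fields M"
  shows "compose_fields X Y x \<in> functionals M"
proof -
  note l = vector_field_functionals[OF X, of x] vector_field_functionals[OF Y]
  have "compose_fields X Y x (f + g) = compose_fields X Y x f + compose_fields X Y x g"
    if "f \<in> smooth_fun M" "g \<in> smooth_fun M" for f g
    using functionals_add[OF l(2) that] functionals_add[OF l(1) vector_field_smooth[OF Y that(1)]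
        vector_field_smooth[OF Y that(2)]]
    by (simp add: compose_fields_def plus_fun_def)
  moreover have "compose_fields X Y x (c *\<^sub>R f) = c * compose_fields X Y x f"
    if "f \<in> smooth_fun M" for f c
    using functionals_cmult[OF l(2) that] functionals_cmult[OF l(1) vector_field_smooth[OF Y that]]
    by (simp add: compose_fields_def scaleR_fun_def)
  ultimately show ?thesis
    using compose_fields_nonsmooth[OF X Y] by (simp add: functionals_def)
qed

text \<open>The two middle terms are symmetric in \<open>X\<close> and \<open>Y\<close> up to order;
  this is why they cancel in the bracket, which is thereby a derivation.\<close>

lemma compose_fields_mult:
  assumes X: "X \<in> vector_fields M" and Y: "Y \<in> vector_fields M"
    and f: "f \<in> smooth_fun M" and g: "g \<in> smooth_fun M"
  shows "compose_fields X Y x (\<lambda>y. f y * g y) =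
    f x * compose_fields X Y x g + X x f * Y x g + X x g * Y x f + g x * compose_fields X Y x f"
proof -
  note s = vector_field_smooth[OF Y f] vector_field_smooth[OF Y g]
  have "compose_fields X Y x (\<lambda>y. f y * g y) = X x (\<lambda>y. f y * Y y g + g y * Y y f)"
    using tangent_mult[OF vector_field_tangent[OF Y] f g] by (simp add: compose_fields_def)
  also have "\<dots> = X x (\<lambda>y. f y * Y y g) + X x (\<lambda>y. g y * Y y f)"
    by (rule functionals_add[OF vector_field_functionals[OF X] smooth_fun_mult[OF f s(2)]
          smooth_fun_mult[OF g s(1)]])
  finally show ?thesis
    using tangent_mult[OF vector_field_tangent[OF X] f s(2), of x]
      tangent_mult[OF vector_field_tangent[OF X] g s(1), of x]
    by (simp add: compose_fields_def)
qed

lemma compose_fields_tangent2: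
  assumes X: "X \<in> vector_fields M" and Y: "Y \<in> vector_fields M"
  shows "compose_fields X Y x \<in> tangent2_space M x"
proof -
  \<comment> \<open>The product rule is applied to \<open>f * g\<close> and \<open>k\<close>: both
    \<open>f * g\<close> and its first derivatives vanish at \<open>x\<close>, and so does
    \<open>k\<close>.\<close>
  have "compose_fields X Y x (f * g * k) = 0"
    if "f \<in> smooth_fun M" "g \<in> smooth_fun M" "k \<in> smooth_fun M" "f x = 0" "g x = 0" "k x = 0" for f g k
    using that compose_fields_mult[OF X Y smooth_fun_mult[OF that(1,2)] that(3), of x]
      tangent_mult[OF vector_field_tangent[OF X, of x] that(1,2)]
      tangent_mult[OF vector_field_tangent[OF Y, of x] that(1,2)]
    by (simp add: times_fun_def)
  moreover have "compose_fields X Y x (\<lambda>_. 1) = 0"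
    using tangent_one[OF vector_field_tangent[OF Y]] functionals_zero[OF vector_field_functionals[OF X]]
    by (simp add: compose_fields_def)
  ultimately show ?thesis
    using compose_fields_functionals[OF X Y] by (simp add: tangent2_space_def)
qed

lemma bracket_vector_field:
  assumes X: "X \<in> vector_fields M" and Y: "Y \<in> vector_fields M"
  shows "bracket X Y \<in> vector_fields M"
proof -
  have "bracket X Y x \<in> functionals M" for x
    unfolding bracket_def
    using subspace_diff[OF subspace_functionals compose_fields_functionals[OF X Y]
        compose_fields_functionals[OF Y X]] by simp
  moreover have "bracket X Y x (f * g) = f x * bracket X Y x g + g x * bracket X Y x f"
    if "f \<in> smooth_fun M" "g \<in> smooth_fun M" for f g x
    using compose_fields_mult[OF X Y that, of x] compose_fields_mult[OF Y X that, of x]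
    by (simp add: bracket_def times_fun_def algebra_simps)
  moreover have "(\<lambda>x. bracket X Y x f) \<in> smooth_fun M" if "f \<in> smooth_fun M" for f
    using smooth_fun_diff[OF vector_field_smooth[OF X vector_field_smooth[OF Y that]]
        vector_field_smooth[OF Y vector_field_smooth[OF X that]]]
    by (simp add: bracket_def compose_fields_def)
  ultimately show ?thesis
    by (auto simp: smooth_sections_def tangent_space_def)
qed

text \<open>The defect \<open>(X f) Y\<close> is the one in the Leibniz rule of a connection. For a
  function that is not smooth, every term is 0 by convention, so the fields are equal as functions
  on all arguments.\<close>

lemma compose_fields_scale_right:
  assumes X: "X \<in> vector_fields M" and Y: "Y \<in> vector_fields M" and f: "f \<in> smooth_fun M"
  shows "compose_fields X (fun_scale f Y) = fun_scale (\<lambda>x. X x f) Y + fun_scale f (compose_fields X Y)"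
proof -
  have "compose_fields X (fun_scale f Y) x g = X x f * Y x g + f x * compose_fields X Y x g" for x g
  proof (cases "g \<in> smooth_fun M")
    case True
    then show ?thesis
      using tangent_mult[OF vector_field_tangent[OF X] f vector_field_smooth[OF Y True], of x]
      by (simp add: compose_fields_def)
  next
    case False
    then show ?thesis
      using compose_fields_nonsmooth[OF X vector_field_scale[OF f Y] False]
        compose_fields_nonsmooth[OF X Y False] vector_field_nonsmooth[OF Y False] by simp
  qed
  then show ?thesis by (auto simp: fun_eq_iff)
qed

lemma compose_fields_scale_left: "compose_fields (fun_scale f X) Y = fun_scale f (compose_fields X Y)"
  by (auto simp: fun_eq_iff compose_fields_def)

lemma compose_fields_add_left: "compose_fields (X + X') Y = compose_fields X Y + compose_fields X' Y"
  by (auto simp: fun_eq_iff compose_fields_def)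

lemma compose_fields_add_right:
  assumes X: "X \<in> vector_fields M" and Y: "Y \<in> vector_fields M" "Y' \<in> vector_fields M"
  shows "compose_fields X (Y + Y') = compose_fields X Y + compose_fields X Y'"
proof -
  have "compose_fields X (Y + Y') x g = compose_fields X Y x g + compose_fields X Y' x g" for x g
  proof (cases "g \<in> smooth_fun M")
    case True
    then show ?thesis
      using functionals_add[OF vector_field_functionals[OF X] vector_field_smooth[OF Y(1) True]
          vector_field_smooth[OF Y(2) True], of x]
      by (simp add: compose_fields_def)
  next
    case False
    then show ?thesis
      using compose_fields_nonsmooth[OF X _ False] Y vector_field_add[OF Y] by simp
  qed
  then show ?thesis by (auto simp: fun_eq_iff)
qed

lemma bracket_add_left:
  assumes "X \<in> vector_fields M" "X' \<in> vector_fields M" "Y \<in> vector_fields M"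
  shows "bracket (X + X') Y = bracket X Y + bracket X' Y"
  using compose_fields_add_right[OF assms(3,1,2)]
  by (simp add: bracket_def compose_fields_add_left)

lemma bracket_add_right:
  assumes "X \<in> vector_fields M" "Y \<in> vector_fields M" "Y' \<in> vector_fields M"
  shows "bracket X (Y + Y') = bracket X Y + bracket X Y'"
  using compose_fields_add_right[OF assms]
  by (simp add: bracket_def compose_fields_add_left)

lemma bracket_scale_right:
  assumes "X \<in> vector_fields M" "Y \<in> vector_fields M" "f \<in> smooth_fun M"
  shows "bracket X (fun_scale f Y) = fun_scale (\<lambda>x. X x f) Y + fun_scale f (bracket X Y)"
  using compose_fields_scale_right[OF assms]
  by (auto simp: bracket_def compose_fields_scale_left fun_eq_iff algebra_simps)

lemma bracket_scale_left:
  assumes "X \<in> vector_fields M" "Y \<in> vector_fields M" "f \<in> smooth_fun M"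
  shows "bracket (fun_scale f X) Y = fun_scale f (bracket X Y) - fun_scale (\<lambda>x. Y x f) X"
  using compose_fields_scale_right[OF assms(2,1,3)]
  by (auto simp: bracket_def compose_fields_scale_left fun_eq_iff algebra_simps)

section \<open>Tensoriality of the second covariant derivative and change of frame\<close>

context
  fixes M :: "('m::{t2_space, second_countable_topology}, 'e::euclidean_space) atlas"
    and nab :: "'m connection"
  assumes M: "smooth_atlas M" and nab: "affine_connection M nab"
begin

lemma affine_connectionD:
  assumes "X \<in> vector_fields M" "Y \<in> vector_fields M"
  shows "nab X Y \<in> vector_fields M"
    and "Z \<in> vector_fields M \<Longrightarrow> nab (X + Z) Y = nab X Y + nab Z Y"
    and "Z \<in> vector_fields M \<Longrightarrow> nab X (Y + Z) = nab X Y + nab X Z"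
    and "f \<in> smooth_fun M \<Longrightarrow> nab (fun_scale f X) Y = fun_scale f (nab X Y)"
    and "f \<in> smooth_fun M \<Longrightarrow>
      nab X (fun_scale f Y) = fun_scale (\<lambda>x. X x f) Y + fun_scale f (nab X Y)"
  using nab assms unfolding affine_connection_def by blast+

text \<open>In the second slot the term \<open>(X f) Y\<close> occurs in the composition and in the
  connection, and the difference removes it.\<close>

lemma second_covariant_linear:
  assumes X: "X \<in> vector_fields M" and Y: "Y \<in> vector_fields M"
  shows "Z \<in> vector_fields M \<Longrightarrow>
      second_covariant nab (X + Z) Y = second_covariant nab X Y + second_covariant nab Z Y"
    and "Z \<in> vector_fields M \<Longrightarrow>
      second_covariant nab X (Y + Z) = second_covariant nab X Y + second_covariant nab X Z"
    and "f \<in> smooth_fun M \<Longrightarrow>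
      second_covariant nab (fun_scale f X) Y = fun_scale f (second_covariant nab X Y)"
    and "f \<in> smooth_fun M \<Longrightarrow>
      second_covariant nab X (fun_scale f Y) = fun_scale f (second_covariant nab X Y)"
  using assms compose_fields_add_right[of X M Y Z] compose_fields_scale_right[of X M Y f]
  by (auto simp: second_covariant_def affine_connectionD compose_fields_add_left
      compose_fields_scale_left fun_eq_iff algebra_simps)

lemma second_covariant_local_left:
  assumes X: "X \<in> vector_fields M" "X' \<in> vector_fields M" and Y: "Y \<in> vector_fields M"
    and U: "open U" "x \<in> U" "\<And>y. y \<in> U \<Longrightarrow> X y = X' y"
  shows "second_covariant nab X Y x = second_covariant nab X' Y x"
proof -
  obtain \<phi> where \<phi>: "\<phi> \<in> smooth_fun M" "\<phi> x = 0" "\<And>y. y \<notin> U \<Longrightarrow> \<phi> y = 1"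
    using smooth_bump[OF M U(1,2)] by blast
  \<comment> \<open>On \<open>U\<close> the difference vanishes; off \<open>U\<close> the factor is
    1 and restores \<open>X\<close>.\<close>
  have "X = X' + fun_scale \<phi> (X - X')"
  proof
    fix y show "X y = (X' + fun_scale \<phi> (X - X')) y"
      using U(3) \<phi>(3) by (cases "y \<in> U") auto
  qed
  then show ?thesis
    using second_covariant_linear(1)[OF X(2) Y vector_field_scale[OF \<phi>(1) vector_field_diff[OF X]]]
      second_covariant_linear(3)[OF vector_field_diff[OF X] Y \<phi>(1)] \<phi>(2) by simp
qed

lemma second_covariant_local_right:
  assumes X: "X \<in> vector_fields M" and Y: "Y \<in> vector_fields M" "Y' \<in> vector_fields M"
    and U: "open U" "x \<in> U" "\<And>y. y \<in> U \<Longrightarrow> Y y = Y' y"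
  shows "second_covariant nab X Y x = second_covariant nab X Y' x"
proof -
  obtain \<phi> where \<phi>: "\<phi> \<in> smooth_fun M" "\<phi> x = 0" "\<And>y. y \<notin> U \<Longrightarrow> \<phi> y = 1"
    using smooth_bump[OF M U(1,2)] by blast
  have "Y = Y' + fun_scale \<phi> (Y - Y')"
  proof
    fix y show "Y y = (Y' + fun_scale \<phi> (Y - Y')) y"
      using U(3) \<phi>(3) by (cases "y \<in> U") auto
  qed
  then show ?thesis
    using second_covariant_linear(2)[OF X Y(2) vector_field_scale[OF \<phi>(1) vector_field_diff[OF Y]]]
      second_covariant_linear(4)[OF X vector_field_diff[OF Y] \<phi>(1)] \<phi>(2) by simp
qed

lemma second_covariant_sum_left:
  assumes "\<And>i. i \<in> I \<Longrightarrow> c i \<in> smooth_fun M" "\<And>i. i \<in> I \<Longrightarrow> A i \<in> vector_fields M"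
    and Y: "Y \<in> vector_fields M"
  shows "second_covariant nab (\<Sum>i\<in>I. fun_scale (c i) (A i)) Y x =
    (\<Sum>i\<in>I. c i x *\<^sub>R second_covariant nab (A i) Y x)"
  using assms(1,2)
proof (induction I rule: infinite_finite_induct)
  case (insert i I)
  have c: "c i \<in> smooth_fun M" and A: "A i \<in> vector_fields M"
    and F: "(\<Sum>i\<in>I. fun_scale (c i) (A i)) \<in> vector_fields M"
    using insert.prems by (auto intro!: vector_field_sum vector_field_scale)
  have "second_covariant nab (fun_scale (c i) (A i) + (\<Sum>i\<in>I. fun_scale (c i) (A i))) Y =
      fun_scale (c i) (second_covariant nab (A i) Y) + second_covariant nab (\<Sum>i\<in>I. fun_scale (c i) (A i)) Y"
    by (simp only: second_covariant_linear(1)[OF vector_field_scale[OF c A] Y F]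
        second_covariant_linear(3)[OF A Y c])
  moreover have "second_covariant nab (\<Sum>i\<in>I. fun_scale (c i) (A i)) Y x = (\<Sum>i\<in>I. c i x *\<^sub>R second_covariant nab (A i) Y x)"
    using insert.prems by (intro insert.IH) auto
  ultimately show ?case
    by (simp only: sum.insert[OF insert.hyps] plus_fun_apply[of _ _ x] fun_scale_apply[of _ _ x])
\<comment> \<open>Empty and infinite index sets: the zero field is 0 times itself, so
  function-linearity gives the value 0.\<close>
qed (use second_covariant_linear(3)[OF vector_field_zero Y smooth_fun_const[of 0]] in
    \<open>auto simp: fun_scale_def zero_fun_def\<close>)

lemma second_covariant_sum_right:
  assumes "\<And>i. i \<in> I \<Longrightarrow> c i \<in> smooth_fun M" "\<And>i. i \<in> I \<Longrightarrow> A i \<in> vector_fields M"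
    and X: "X \<in> vector_fields M"
  shows "second_covariant nab X (\<Sum>i\<in>I. fun_scale (c i) (A i)) x =
    (\<Sum>i\<in>I. c i x *\<^sub>R second_covariant nab X (A i) x)"
  using assms(1,2)
proof (induction I rule: infinite_finite_induct)
  case (insert i I)
  have c: "c i \<in> smooth_fun M" and A: "A i \<in> vector_fields M"
    and F: "(\<Sum>i\<in>I. fun_scale (c i) (A i)) \<in> vector_fields M"
    using insert.prems by (auto intro!: vector_field_sum vector_field_scale)
  have "second_covariant nab X (fun_scale (c i) (A i) + (\<Sum>i\<in>I. fun_scale (c i) (A i))) =
      fun_scale (c i) (second_covariant nab X (A i)) + second_covariant nab X (\<Sum>i\<in>I. fun_scale (c i) (A i))"
    by (simp only: second_covariant_linear(2)[OF X vector_field_scale[OF c A] F]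
        second_covariant_linear(4)[OF X A c])
  moreover have "second_covariant nab X (\<Sum>i\<in>I. fun_scale (c i) (A i)) x = (\<Sum>i\<in>I. c i x *\<^sub>R second_covariant nab X (A i) x)"
    using insert.prems by (intro insert.IH) auto
  ultimately show ?case
    by (simp only: sum.insert[OF insert.hyps] plus_fun_apply[of _ _ x] fun_scale_apply[of _ _ x])
qed (use second_covariant_linear(4)[OF X vector_field_zero smooth_fun_const[of 0]] in
    \<open>auto simp: fun_scale_def zero_fun_def\<close>)

text \<open>Change of basis for a bilinear form: summing the products
  \<open>c j i x * c j k x\<close> over \<open>j\<close> leaves the identity matrix. The expansion
  of \<open>E j\<close> is asked on a neighbourhood because locality of
  \<open>second_covariant\<close> was proved for fields that agree near \<open>x\<close>;
  orthogonality enters only at \<open>x\<close>.\<close>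

lemma trace_second_covariant_frame:
  fixes c :: "'j \<Rightarrow> 'i \<Rightarrow> 'm \<Rightarrow> real"
  assumes J: "finite J" and I: "finite I"
    and E: "\<And>j. j \<in> J \<Longrightarrow> E j \<in> vector_fields M" and A: "\<And>i. i \<in> I \<Longrightarrow> A i \<in> vector_fields M"
    and c: "\<And>j i. j \<in> J \<Longrightarrow> i \<in> I \<Longrightarrow> c j i \<in> smooth_fun M"
    and U: "open U" "x \<in> U" "\<And>j y. j \<in> J \<Longrightarrow> y \<in> U \<Longrightarrow> E j y = (\<Sum>i\<in>I. c j i y *\<^sub>R A i y)"
    and orth: "\<And>i k. i \<in> I \<Longrightarrow> k \<in> I \<Longrightarrow> (\<Sum>j\<in>J. c j i x * c j k x) = (if i = k then 1 else 0)"
  shows "(\<Sum>j\<in>J. second_covariant nab (E j) (E j) x) = (\<Sum>i\<in>I. second_covariant nab (A i) (A i) x)"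
proof -
  let ?Q = "second_covariant nab"
  have "?Q (E j) (E j) x = (\<Sum>i\<in>I. \<Sum>k\<in>I. (c j i x * c j k x) *\<^sub>R ?Q (A i) (A k) x)" if j: "j \<in> J" for j
  proof -
    let ?E = "\<Sum>i\<in>I. fun_scale (c j i) (A i)"
    have F: "?E \<in> vector_fields M"
      using c[OF j] A by (intro vector_field_sum vector_field_scale) auto
    have eq: "E j y = ?E y" if "y \<in> U" for y
      using U(3)[OF j that] by (simp add: sum_fun_apply)
    \<comment> \<open>The global combination agrees with \<open>E j\<close> on \<open>U\<close>
      only, so the two slots are replaced one after the other by locality.\<close>
    have "?Q (E j) (E j) x = ?Q ?E ?E x"
      using second_covariant_local_left[OF E[OF j] F E[OF j] U(1,2) eq]
        second_covariant_local_right[OF F E[OF j] F U(1,2) eq] by simp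
    also have "\<dots> = (\<Sum>i\<in>I. c j i x *\<^sub>R ?Q (A i) ?E x)"
      by (intro second_covariant_sum_left c[OF j] A F)
    also have "\<dots> = (\<Sum>i\<in>I. c j i x *\<^sub>R (\<Sum>k\<in>I. c j k x *\<^sub>R ?Q (A i) (A k) x))"
      by (intro sum.cong refl arg_cong[where f = "\<lambda>v. _ *\<^sub>R v"] second_covariant_sum_right c[OF j] A)
    finally show ?thesis by (simp add: scaleR_sum_right)
  qed
  then have "(\<Sum>j\<in>J. ?Q (E j) (E j) x) =
      (\<Sum>j\<in>J. \<Sum>i\<in>I. \<Sum>k\<in>I. (c j i x * c j k x) *\<^sub>R ?Q (A i) (A k) x)"
    by simp
  also have "\<dots> = (\<Sum>i\<in>I. \<Sum>k\<in>I. \<Sum>j\<in>J. (c j i x * c j k x) *\<^sub>R ?Q (A i) (A k) x)"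
    by (subst sum.swap) (intro sum.cong refl sum.swap)
  also have "\<dots> = (\<Sum>i\<in>I. \<Sum>k\<in>I. (if i = k then 1 else 0) *\<^sub>R ?Q (A i) (A k) x)"
    by (intro sum.cong refl) (simp add: scaleR_sum_left[symmetric] orth)
  also have "\<dots> = (\<Sum>i\<in>I. ?Q (A i) (A i) x)"
  proof (intro sum.cong refl)
    fix i assume "i \<in> I"
    have "(\<Sum>k\<in>I. (if i = k then 1 else 0) *\<^sub>R ?Q (A i) (A k) x) =
        (\<Sum>k\<in>I. if i = k then ?Q (A i) (A k) x else 0)"
      by (intro sum.cong) auto
    then show "(\<Sum>k\<in>I. (if i = k then 1 else 0) *\<^sub>R ?Q (A i) (A k) x) = ?Q (A i) (A i) x"
      using \<open>i \<in> I\<close> I by simp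
  qed
  finally show ?thesis .
qed

end

section \<open>Metrics and complementary subbundles\<close>

lemma linear_between_0: "linear_between V W \<phi> \<Longrightarrow> subspace V \<Longrightarrow> \<phi> 0 = 0"
  unfolding linear_between_def using subspace_0[of V] by (metis scaleR_zero_left)

lemma linear_between_diff:
  assumes "linear_between V W \<phi>" "subspace V" "u \<in> V" "v \<in> V"
  shows "\<phi> (u - v) = \<phi> u - \<phi> v"
proof -
  have "\<phi> (u - v) + \<phi> v = \<phi> (u - v + v)"
    using assms subspace_diff[OF assms(2)] unfolding linear_between_def by metis
  also have "\<dots> = \<phi> u" by simp
  finally show ?thesis by (simp only: eq_diff_eq)
qed

lemma linear_between_sum:
  assumes \<phi>: "linear_between V W \<phi>" and V: "subspace V" and u: "\<And>i. i \<in> I \<Longrightarrow> u i \<in> V"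
  shows "\<phi> (\<Sum>i\<in>I. u i) = (\<Sum>i\<in>I. \<phi> (u i))"
  using u
proof (induction I rule: infinite_finite_induct)
  case (insert i I)
  have "\<phi> (u i + (\<Sum>i\<in>I. u i)) = \<phi> (u i) + \<phi> (\<Sum>i\<in>I. u i)"
    using \<phi> insert.prems subspace_sum[OF V, of I u] unfolding linear_between_def by blast
  moreover have "\<phi> (\<Sum>i\<in>I. u i) = (\<Sum>i\<in>I. \<phi> (u i))"
    using insert.prems by (intro insert.IH) auto
  ultimately show ?case
    by (simp only: sum.insert[OF insert.hyps])
qed (simp_all add: linear_between_0[OF \<phi> V])

text \<open>The vectors that have this expansion form a subspace containing every
  \<open>e i\<close>, hence contain the span. Membership in \<open>T\<close> is carried along
  because \<open>g\<close> is linear only there.\<close>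

lemma orthonormal_expansion:
  assumes T: "subspace T" and g: "\<And>w. w \<in> T \<Longrightarrow> linear_between T UNIV (\<lambda>u. g u w :: real)"
    and e: "\<And>i. i \<in> I \<Longrightarrow> e i \<in> T" and I: "finite I"
    and orth: "\<And>i j. i \<in> I \<Longrightarrow> j \<in> I \<Longrightarrow> g (e i) (e j) = (if i = j then 1 else 0)"
    and u: "u \<in> span (e ` I)"
  shows "u = (\<Sum>i\<in>I. g u (e i) *\<^sub>R e i)"
proof -
  let ?P = "\<lambda>u. u \<in> T \<and> u = (\<Sum>i\<in>I. g u (e i) *\<^sub>R e i)"
  have "?P u"
    using u
  proof (rule span_induct)
    have add: "g (a + b) (e i) = g a (e i) + g b (e i)" if "a \<in> T" "b \<in> T" "i \<in> I" for a b i
      using g[OF e[OF that(3)]] that unfolding linear_between_def by blast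
    have scale: "g (c *\<^sub>R a) (e i) = c * g a (e i)" if "a \<in> T" "i \<in> I" for a c i
      using g[OF e[OF that(2)]] that unfolding linear_between_def by simp
    show "subspace {u. ?P u}"
    proof (rule subspaceI)
      have "g 0 (e i) = 0" if "i \<in> I" for i
        using linear_between_0[OF g[OF e[OF that]] T] .
      then show "0 \<in> {u. ?P u}" using subspace_0[OF T] by simp
    next
      fix a b assume ab: "a \<in> {u. ?P u}" "b \<in> {u. ?P u}"
      have "(\<Sum>i\<in>I. g (a + b) (e i) *\<^sub>R e i) =
          (\<Sum>i\<in>I. g a (e i) *\<^sub>R e i) + (\<Sum>i\<in>I. g b (e i) *\<^sub>R e i)"
        using ab by (simp add: sum.distrib add scaleR_add_left)
      also have "\<dots> = a + b"
        using ab by simp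
      finally have "a + b = (\<Sum>i\<in>I. g (a + b) (e i) *\<^sub>R e i)" ..
      then show "a + b \<in> {u. ?P u}" using ab subspace_add[OF T] by blast
    next
      fix c :: real and a assume a: "a \<in> {u. ?P u}"
      then have aT: "a \<in> T" by simp
      have "(\<Sum>i\<in>I. g (c *\<^sub>R a) (e i) *\<^sub>R e i) = c *\<^sub>R (\<Sum>i\<in>I. g a (e i) *\<^sub>R e i)"
        using aT by (simp add: scaleR_sum_right scale)
      also have "\<dots> = c *\<^sub>R a"
        using a by simp
      finally have "c *\<^sub>R a = (\<Sum>i\<in>I. g (c *\<^sub>R a) (e i) *\<^sub>R e i)" ..
      then show "c *\<^sub>R a \<in> {u. ?P u}" using a subspace_scale[OF T] by blast
    qed
  next
    fix v assume "v \<in> e ` I"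
    then obtain j where j: "j \<in> I" "v = e j" by blast
    have "(\<Sum>i\<in>I. g (e j) (e i) *\<^sub>R e i) = (\<Sum>i\<in>I. if j = i then e i else 0)"
      using orth[OF j(1)] by (intro sum.cong) auto
    also have "\<dots> = e j" using I j(1) by simp
    finally show "?P v" using j e by simp
  qed
  then show ?thesis by blast
qed

lemma riemannian_metric_linear:
  "riemannian_metric M g \<Longrightarrow> w \<in> tangent_space M x \<Longrightarrow>
     linear_between (tangent_space M x) UNIV (\<lambda>u. g x u w)"
  unfolding riemannian_metric_def by blast

lemma riemannian_metric_sym:
  "riemannian_metric M g \<Longrightarrow> u \<in> tangent_space M x \<Longrightarrow> v \<in> tangent_space M x \<Longrightarrow> g x u v = g x v u"
  unfolding riemannian_metric_def by blast

lemma riemannian_metric_smooth: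
  "riemannian_metric M g \<Longrightarrow> X \<in> vector_fields M \<Longrightarrow> Y \<in> vector_fields M \<Longrightarrow>
     (\<lambda>x. g x (X x) (Y x)) \<in> smooth_fun M"
  unfolding riemannian_metric_def by blast

lemmas riemannian_metric_diff =
  linear_between_diff[OF riemannian_metric_linear subspace_tangent]

text \<open>Metric compatibility is used for the three cyclic choices and torsion-freeness for the
  three brackets; by symmetry of \<open>g\<close> all derivatives but one cancel. The right-hand
  side mentions only the metric and brackets, which can be compared between \<open>M\<close> and
  \<open>B\<close>.\<close>

lemma koszul:
  assumes g: "riemannian_metric M g" and nab: "levi_civita M g nab"
    and X: "X \<in> vector_fields M" and Y: "Y \<in> vector_fields M" and Z: "Z \<in> vector_fields M"
  shows "2 * g x (nab X Y x) (Z x) =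
    X x (\<lambda>y. g y (Y y) (Z y)) + Y x (\<lambda>y. g y (X y) (Z y)) - Z x (\<lambda>y. g y (X y) (Y y)) +
    g x (bracket X Y x) (Z x) - g x (bracket X Z x) (Y x) - g x (bracket Y Z x) (X x)"
proof -
  have compat: "X x (\<lambda>y. g y (Y y) (Z y)) = g x (nab X Y x) (Z x) + g x (Y x) (nab X Z x)"
    if "X \<in> vector_fields M" "Y \<in> vector_fields M" "Z \<in> vector_fields M" for X Y Z
    using nab that unfolding levi_civita_def by blast
  have T: "nab X Y x \<in> tangent_space M x" if "X \<in> vector_fields M" "Y \<in> vector_fields M" for X Y
    using nab that unfolding levi_civita_def affine_connection_def by (blast intro: vector_field_tangent)
  have torsion: "g x (bracket X Y x) (Z x) = g x (nab X Y x) (Z x) - g x (nab Y X x) (Z x)"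
    if "X \<in> vector_fields M" "Y \<in> vector_fields M" "Z \<in> vector_fields M" for X Y Z
  proof -
    have "bracket X Y = nab X Y - nab Y X"
      using nab that(1,2) unfolding levi_civita_def by metis
    then have "bracket X Y x = nab X Y x - nab Y X x" by simp
    then show ?thesis
      using riemannian_metric_diff[OF g vector_field_tangent[OF that(3)] T[OF that(1,2)] T[OF that(2,1)]]
      by simp
  qed
  have sym: "g x (X x) (nab Y Z x) = g x (nab Y Z x) (X x)"
    if "X \<in> vector_fields M" "Y \<in> vector_fields M" "Z \<in> vector_fields M" for X Y Z
    using riemannian_metric_sym[OF g vector_field_tangent[OF that(1)] T[OF that(2,3)]] .
  show ?thesis
    using X Y Z by (simp add: compat torsion sym)
qed

section \<open>Projections along complementary subbundles and the adapted connection\<close>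

lemma direct_sum_commute: "direct_sum E H V \<Longrightarrow> direct_sum E V H"
  unfolding direct_sum_def by (auto simp: Int_commute) (metis add.commute)+

text \<open>This gives the description operator in \<open>pr\<close> its meaning: two candidates
  differ by an element of \<open>H \<inter> V\<close>.\<close>

lemma direct_sum_decompose:
  assumes "direct_sum E H V" "v \<in> E"
  shows "\<exists>!a. a \<in> H \<and> v - a \<in> V"
proof -
  have H: "subspace H" and V: "subspace V" and HV: "H \<inter> V = {0}"
    and E: "{a + b |a b. a \<in> H \<and> b \<in> V} = E"
    using assms(1) unfolding direct_sum_def by blast+
  obtain a b where "v = a + b" "a \<in> H" "b \<in> V" using E assms(2) by blast
  then have "a \<in> H \<and> v - a \<in> V" by simp
  moreover have "c = a" if "c \<in> H \<and> v - c \<in> V" "a \<in> H \<and> v - a \<in> V" for a c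
  proof -
    have "(v - a) - (v - c) \<in> V" using that V by (blast intro: subspace_diff)
    moreover have "(v - a) - (v - c) = c - a" by simp
    ultimately have "c - a \<in> V" by simp
    then have "c - a \<in> H \<inter> V" using that H by (blast intro: subspace_diff)
    then show ?thesis using HV by auto
  qed
  ultimately show ?thesis by blast
qed

context
  fixes T H V :: "'m \<Rightarrow> 'm functional set"
  assumes ds: "\<And>x. direct_sum (T x) (H x) (V x)"
begin

lemma pr_decompose:
  assumes "\<And>x. X x \<in> T x"
  shows "pr H V X x \<in> H x" "X x - pr H V X x \<in> V x"
  using theI'[OF direct_sum_decompose[OF ds assms, of x]] unfolding pr_def by blast+

lemma pr_eqI:
  assumes "\<And>x. X x \<in> T x" "a \<in> H x" "X x - a \<in> V x"
  shows "pr H V X x = a"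
  unfolding pr_def using assms(2,3) by (intro the1_equality[OF direct_sum_decompose[OF ds assms(1)]] conjI)

lemma pr_swap:
  assumes "\<And>x. X x \<in> T x"
  shows "pr V H X x = X x - pr H V X x"
  unfolding pr_def[of V H]
proof (rule the1_equality[OF direct_sum_decompose[OF direct_sum_commute[OF ds] assms]])
  show "X x - pr H V X x \<in> V x \<and> X x - (X x - pr H V X x) \<in> H x"
    using pr_decompose[OF assms] by (simp only: diff_diff_eq2 add_diff_cancel_left')
qed

lemma subspace_summands: "subspace (H x)" "subspace (V x)"
  using ds[of x] unfolding direct_sum_def by blast+

lemma summand_subset: "H x \<subseteq> T x"
proof
  fix a assume "a \<in> H x"
  then have "a + 0 \<in> {a + b |a b. a \<in> H x \<and> b \<in> V x}"
    using subspace_0[OF subspace_summands(2)] by blast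
  then show "a \<in> T x" using ds[of x] unfolding direct_sum_def by simp
qed

lemma pr_add:
  assumes "\<And>x. X x \<in> T x" "\<And>x. Y x \<in> T x" "\<And>x. subspace (T x)"
  shows "pr H V (X + Y) = pr H V X + pr H V Y"
proof
  fix x
  have "(X x - pr H V X x) + (Y x - pr H V Y x) \<in> V x"
    by (intro subspace_add subspace_summands pr_decompose(2) assms)
  then have "(X + Y) x - (pr H V X x + pr H V Y x) \<in> V x"
    by (simp only: plus_fun_apply[of _ _ x] add_diff_add)
  then have "pr H V (X + Y) x = pr H V X x + pr H V Y x"
    by (intro pr_eqI subspace_add subspace_summands pr_decompose(1) assms)
      (simp_all add: subspace_add assms)
  then show "pr H V (X + Y) x = (pr H V X + pr H V Y) x"
    by (simp only: plus_fun_apply[of _ _ x])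
qed

lemma pr_scale:
  assumes "\<And>x. X x \<in> T x" "\<And>x. subspace (T x)"
  shows "pr H V (fun_scale f X) = fun_scale f (pr H V X)"
proof
  fix x
  have "f x *\<^sub>R (X x - pr H V X x) \<in> V x"
    by (intro subspace_scale subspace_summands pr_decompose(2) assms)
  then have "pr H V (fun_scale f X) x = f x *\<^sub>R pr H V X x"
    by (intro pr_eqI subspace_scale subspace_summands pr_decompose(1) assms)
      (simp_all only: fun_scale_apply subspace_scale assms scaleR_diff_right)
  then show "pr H V (fun_scale f X) x = fun_scale f (pr H V X) x" by (simp only: fun_scale_apply[of _ _ x])
qed

lemma pr_id:
  assumes X: "\<And>x. X x \<in> H x"
  shows "pr H V X = X"
proof
  fix x
  have "X x - X x \<in> V x" using subspace_0[OF subspace_summands(2)] by (simp only: diff_self)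
  then show "pr H V X x = X x"
    using summand_subset X by (intro pr_eqI) blast+
qed

lemma pr_complement:
  assumes T: "\<And>x. X x \<in> T x" and X: "\<And>x. X x \<in> V x"
  shows "pr H V X = 0"
proof
  fix x
  have "X x - 0 \<in> V x" using X by (simp only: diff_zero)
  then have "pr H V X x = 0"
    using T subspace_0[OF subspace_summands(1)] by (intro pr_eqI)
  then show "pr H V X x = 0 x" by (simp only: zero_fun_apply)
qed

end

lemma pr_vector_field_swap:
  assumes ds: "\<And>x. direct_sum (tangent_space M x) (H x) (V x)"
    and X: "X \<in> vector_fields M" "pr H V X \<in> vector_fields M"
  shows "pr V H X \<in> vector_fields M"
proof -
  have "pr V H X = X - pr H V X"
  proof
    fix x show "pr V H X x = (X - pr H V X) x"
      using pr_swap[where T = "tangent_space M", OF ds vector_field_tangent[OF X(1)], of x]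
      by (simp only: minus_apply)
  qed
  then show ?thesis using vector_field_diff[OF X] by simp
qed

text \<open>In the first slot, scaling inside the bracket \<open>[vX, hY]\<close> produces an extra
  multiple of \<open>vX\<close>, which the outer projection to \<open>H\<close> annihilates;
  likewise with the roles exchanged. In the second slot, the horizontal part receives
  \<open>(hX f) hY\<close> from the connection and \<open>(vX f) hY\<close> from the bracket, which
  add up to \<open>(X f) hY\<close>; the vertical part is analogous.\<close>

lemma adapted_connection_affine:
  assumes ds: "\<And>x. direct_sum (tangent_space M x) (H x) (V x)"
    and nab: "affine_connection M nab"
    and pr: "\<And>X. X \<in> vector_fields M \<Longrightarrow> pr H V X \<in> vector_fields M"
  shows "affine_connection M (adapted_connection H V nab)"
proof -
  let ?h = "pr H V" and ?v = "pr V H"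
  note ds' = direct_sum_commute[OF ds]
  have h: "?h X \<in> vector_fields M" and v: "?v X \<in> vector_fields M" if "X \<in> vector_fields M" for X
    using pr[OF that] pr_vector_field_swap[OF ds that] by blast+
  note T = vector_field_tangent
  have h_add: "?h (X + Y) = ?h X + ?h Y" and v_add: "?v (X + Y) = ?v X + ?v Y"
    if "X \<in> vector_fields M" "Y \<in> vector_fields M" for X Y
    using pr_add[where T = "tangent_space M", OF ds T[OF that(1)] T[OF that(2)] subspace_tangent]
      pr_add[where T = "tangent_space M", OF ds' T[OF that(1)] T[OF that(2)] subspace_tangent] by blast+
  have h_scale: "?h (fun_scale f X) = fun_scale f (?h X)" and v_scale: "?v (fun_scale f X) = fun_scale f (?v X)"
    if "X \<in> vector_fields M" for X f
    using pr_scale[where T = "tangent_space M", OF ds T[OF that] subspace_tangent]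
      pr_scale[where T = "tangent_space M", OF ds' T[OF that] subspace_tangent] by blast+
  have in_H: "?h X x \<in> H x" and in_V: "?v X x \<in> V x" if "X \<in> vector_fields M" for X x
    using pr_decompose(1)[where T = "tangent_space M", OF ds T[OF that]]
      pr_decompose(1)[where T = "tangent_space M", OF ds' T[OF that]] by blast+
  have hh: "?h (?h X) = ?h X" and vv: "?v (?v X) = ?v X" and hv: "?h (?v X) = 0" and vh: "?v (?h X) = 0"
    if "X \<in> vector_fields M" for X
    using pr_id[where T = "tangent_space M", OF ds in_H[OF that]]
      pr_id[where T = "tangent_space M", OF ds' in_V[OF that]]
      pr_complement[where T = "tangent_space M", OF ds T[OF v[OF that]] in_V[OF that]]
      pr_complement[where T = "tangent_space M", OF ds' T[OF h[OF that]] in_H[OF that]] by blast+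
  have split: "X x f = ?h X x f + ?v X x f" if "X \<in> vector_fields M" for X x f
    using pr_swap[where T = "tangent_space M", OF ds T[OF that]] by simp
  have nabD: "nab X Y \<in> vector_fields M" "nab (X + Z) Y = nab X Y + nab Z Y"
    "nab X (Y + Z) = nab X Y + nab X Z"
    if "X \<in> vector_fields M" "Y \<in> vector_fields M" "Z \<in> vector_fields M" for X Y Z
    using nab that unfolding affine_connection_def by blast+
  have nab_scale: "nab (fun_scale f X) Y = fun_scale f (nab X Y)"
    "nab X (fun_scale f Y) = fun_scale (\<lambda>x. X x f) Y + fun_scale f (nab X Y)"
    if "X \<in> vector_fields M" "Y \<in> vector_fields M" "f \<in> smooth_fun M" for X Y f
    using nab that unfolding affine_connection_def by blast+
  note fields = h v nabD(1) bracket_vector_field vector_field_add vector_field_scale vector_field_smooth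
  show ?thesis
    unfolding affine_connection_def
  proof (intro conjI ballI)
    fix X Y assume XY: "X \<in> vector_fields M" "Y \<in> vector_fields M"
    show "adapted_connection H V nab X Y \<in> vector_fields M"
      unfolding adapted_connection_def using XY by (intro fields)
    {
      fix Z assume Z: "Z \<in> vector_fields M"
      have "?h (nab (?h (X + Y)) (?h Z)) = ?h (nab (?h X) (?h Z)) + ?h (nab (?h Y) (?h Z))"
        using XY Z by (simp only: h_add nabD fields)
      moreover have "?v (nab (?v (X + Y)) (?v Z)) = ?v (nab (?v X) (?v Z)) + ?v (nab (?v Y) (?v Z))"
        using XY Z by (simp only: v_add nabD fields)
      moreover have "?h (bracket (?v (X + Y)) (?h Z)) = ?h (bracket (?v X) (?h Z)) + ?h (bracket (?v Y) (?h Z))"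
        using XY Z by (simp only: h_add v_add bracket_add_left[of _ M] fields)
      moreover have "?v (bracket (?h (X + Y)) (?v Z)) = ?v (bracket (?h X) (?v Z)) + ?v (bracket (?h Y) (?v Z))"
        using XY Z by (simp only: h_add v_add bracket_add_left[of _ M] fields)
      ultimately show "adapted_connection H V nab (X + Y) Z =
          adapted_connection H V nab X Z + adapted_connection H V nab Y Z"
        unfolding adapted_connection_def by (simp only: add.assoc add.left_commute add.commute)
      have "?h (nab (?h X) (?h (Y + Z))) = ?h (nab (?h X) (?h Y)) + ?h (nab (?h X) (?h Z))"
        using XY Z by (simp only: h_add nabD fields)
      moreover have "?v (nab (?v X) (?v (Y + Z))) = ?v (nab (?v X) (?v Y)) + ?v (nab (?v X) (?v Z))"
        using XY Z by (simp only: v_add nabD fields)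
      moreover have "?h (bracket (?v X) (?h (Y + Z))) = ?h (bracket (?v X) (?h Y)) + ?h (bracket (?v X) (?h Z))"
        using XY Z by (simp only: h_add v_add bracket_add_right[of _ M] fields)
      moreover have "?v (bracket (?h X) (?v (Y + Z))) = ?v (bracket (?h X) (?v Y)) + ?v (bracket (?h X) (?v Z))"
        using XY Z by (simp only: h_add v_add bracket_add_right[of _ M] fields)
      ultimately show "adapted_connection H V nab X (Y + Z) =
          adapted_connection H V nab X Y + adapted_connection H V nab X Z"
        unfolding adapted_connection_def by (simp only: add.assoc add.left_commute add.commute)
    }
    fix f assume f: "f \<in> smooth_fun M"
    have brackets: "?h (bracket (fun_scale f (?v X)) (?h Y)) = fun_scale f (?h (bracket (?v X) (?h Y)))"
      "?v (bracket (fun_scale f (?h X)) (?v Y)) = fun_scale f (?v (bracket (?h X) (?v Y)))"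
    proof -
      \<comment> \<open>The difference is turned into a sum with coefficient \<open>-1\<close>, so
        that additivity and scaling of the projections apply.\<close>
      have minus: "fun_scale f (bracket A C) - fun_scale (\<lambda>x. C x f) A =
          fun_scale f (bracket A C) + fun_scale (\<lambda>x. -1 * C x f) A" for A C
        by (auto simp: fun_eq_iff)
      have 0: "fun_scale k 0 = (0 :: _ field)" for k :: "_ \<Rightarrow> real"
        by (auto simp: fun_eq_iff)
      show "?h (bracket (fun_scale f (?v X)) (?h Y)) = fun_scale f (?h (bracket (?v X) (?h Y)))"
        "?v (bracket (fun_scale f (?h X)) (?v Y)) = fun_scale f (?v (bracket (?h X) (?v Y)))"
        using XY f by (simp_all only: fields smooth_fun_mult smooth_fun_const h_add v_add h_scale v_scale
            hv vh bracket_scale_left[of _ M] minus 0 add_0_right)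
    qed
    show "adapted_connection H V nab (fun_scale f X) Y = fun_scale f (adapted_connection H V nab X Y)"
      unfolding adapted_connection_def h_scale[OF XY(1)] v_scale[OF XY(1)] brackets
        nab_scale(1)[OF h[OF XY(1)] h[OF XY(2)] f] nab_scale(1)[OF v[OF XY(1)] v[OF XY(2)] f]
        h_scale[OF nabD(1)[OF h[OF XY(1)] h[OF XY(2)] XY(1)]]
        v_scale[OF nabD(1)[OF v[OF XY(1)] v[OF XY(2)] XY(1)]]
      by (auto simp: fun_eq_iff algebra_simps)
    have "?h (nab (?h X) (?h (fun_scale f Y))) =
        fun_scale (\<lambda>x. ?h X x f) (?h Y) + fun_scale f (?h (nab (?h X) (?h Y)))"
      using XY f by (simp only: h_add h_scale hh nab_scale fields)
    moreover have "?v (nab (?v X) (?v (fun_scale f Y))) =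
        fun_scale (\<lambda>x. ?v X x f) (?v Y) + fun_scale f (?v (nab (?v X) (?v Y)))"
      using XY f by (simp only: v_add v_scale vv nab_scale fields)
    moreover have "?h (bracket (?v X) (?h (fun_scale f Y))) =
        fun_scale (\<lambda>x. ?v X x f) (?h Y) + fun_scale f (?h (bracket (?v X) (?h Y)))"
      using XY f by (simp only: h_add h_scale hh bracket_scale_right[of _ M] fields)
    moreover have "?v (bracket (?h X) (?v (fun_scale f Y))) =
        fun_scale (\<lambda>x. ?h X x f) (?v Y) + fun_scale f (?v (bracket (?h X) (?v Y)))"
      using XY f by (simp only: v_add v_scale vv bracket_scale_right[of _ M] fields)
    ultimately show "adapted_connection H V nab X (fun_scale f Y) =
        fun_scale (\<lambda>x. X x f) Y + fun_scale f (adapted_connection H V nab X Y)"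
      unfolding adapted_connection_def
      by (auto simp: fun_eq_iff algebra_simps split[OF XY(1)] split[OF XY(2)])
  qed
qed

section \<open>Horizontal lifts\<close>

lemma levi_civita_vector_field:
  "levi_civita M g nab \<Longrightarrow> X \<in> vector_fields M \<Longrightarrow> Y \<in> vector_fields M \<Longrightarrow> nab X Y \<in> vector_fields M"
  unfolding levi_civita_def affine_connection_def by blast

lemma push_diff: "push B p (u - v) = push B p u - push B p v"
  by (auto simp: push_def fun_eq_iff)

lemma push_scale: "push B p (c *\<^sub>R u) = c *\<^sub>R push B p u"
  by (auto simp: push_def fun_eq_iff)

lemma push_sum: "push B p (\<Sum>i\<in>I. u i) = (\<Sum>i\<in>I. push B p (u i))"
  by (auto simp: push_def fun_eq_iff sum_fun_apply)

locale horizontal_lift =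
  fixes M :: "('m::{t2_space, second_countable_topology}, 'e::euclidean_space) atlas"
    and B :: "('b::{t2_space, second_countable_topology}, 'c::euclidean_space) atlas"
    and p :: "'m \<Rightarrow> 'b"
    and H :: "'m \<Rightarrow> 'm functional set"
    and gB :: "'b metric" and g :: "'m metric"
  assumes atlas: "smooth_atlas M"
    and continuous: "continuous_on UNIV p"
    and push_surj: "\<And>x. push B p ` tangent_space M x = tangent_space B (p x)"
    and sum: "\<And>x. direct_sum (tangent_space M x) (H x) (vertical M B p x)"
    and lift_smooth: "\<And>A. A \<in> vector_fields B \<Longrightarrow> hlift_field B p H A \<in> vector_fields M"
    and gB: "riemannian_metric B gB" and g: "riemannian_metric M g"
    and g_horizontal: "\<And>x u v. u \<in> H x \<Longrightarrow> v \<in> H x \<Longrightarrow> g x u v = gB (p x) (push B p u) (push B p v)"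
    and g_vertical: "\<And>x. {w \<in> tangent_space M x. \<forall>u\<in>H x. g x u w = 0} = vertical M B p x"
    and frame: "\<And>b. \<exists>U n A. b \<in> U \<and> local_orthonormal_basis B (tangent_space B) gB U n A"
begin

abbreviation "V \<equiv> vertical M B p"
abbreviation "lift \<equiv> hlift_field B p H"

lemma H_tangent: "u \<in> H x \<Longrightarrow> u \<in> tangent_space M x"
  using summand_subset[where T = "tangent_space M" and H = H and V = V, OF sum] by blast

lemmas subspace_H = subspace_summands(1)[where T = "tangent_space M" and H = H and V = V, OF sum]
lemmas subspace_V = subspace_summands(2)[where T = "tangent_space M" and H = H and V = V, OF sum]

text \<open>The kernel of the push-forward on tangent vectors is vertical and meets \<open>H\<close>
  only in 0. Equalities of horizontal vectors can therefore be checked on \<open>B\<close>.\<close>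

lemma push_inj_H:
  assumes "u \<in> H x" "v \<in> H x" "push B p u = push B p v"
  shows "u = v"
proof -
  have H: "u - v \<in> H x" using assms(1,2) by (rule subspace_diff[OF subspace_H])
  have "push B p (u - v) = 0" using assms(3) by (simp only: push_diff diff_self)
  then have "u - v \<in> H x \<inter> V x"
    using H H_tangent[OF H] by (simp add: vertical_def)
  moreover have "H x \<inter> V x = {0}"
    using sum[of x] unfolding direct_sum_def by blast
  ultimately have "u - v = 0" by (simp only: singleton_iff)
  then show ?thesis by (simp only: right_minus_eq)
qed

text \<open>Any preimage under the submersion differs from its horizontal part by a vertical vector,
  which the push-forward does not see.\<close>

lemma hlift_ex:
  assumes "w \<in> tangent_space B (p x)"
  shows "\<exists>!v. v \<in> H x \<and> push B p v = w"
proof -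
  obtain v where v: "v \<in> tangent_space M x" "w = push B p v"
    using push_surj[of x] assms by blast
  obtain a where a: "a \<in> H x" "v - a \<in> V x"
    using direct_sum_decompose[OF sum v(1)] by blast
  have "push B p v - push B p a = 0"
    using a(2) by (simp add: vertical_def push_diff[symmetric])
  then have "push B p a = w" using v(2) by (simp only: right_minus_eq)
  then show ?thesis using a(1) push_inj_H by blast
qed

lemma hlift_H: "w \<in> tangent_space B (p x) \<Longrightarrow> hlift B p H x w \<in> H x"
  and push_hlift: "w \<in> tangent_space B (p x) \<Longrightarrow> push B p (hlift B p H x w) = w"
  using theI'[OF hlift_ex] unfolding hlift_def by blast+

lemma lift_H: "A \<in> vector_fields B \<Longrightarrow> lift A x \<in> H x"
  by (simp add: hlift_field_def hlift_H vector_field_tangent)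

lemma push_lift: "A \<in> vector_fields B \<Longrightarrow> push B p (lift A x) = A (p x)"
  by (simp add: hlift_field_def push_hlift vector_field_tangent)

lemma lift_apply:
  assumes "A \<in> vector_fields B" "f \<in> smooth_fun B"
  shows "lift A x (\<lambda>y. f (p y)) = A (p x) f"
  using fun_cong[OF push_lift[OF assms(1), of x], of f] assms(2) by (simp add: push_def comp_def)

text \<open>The vertical part of \<open>u\<close> is orthogonal to \<open>w\<close>. Only
  \<open>w\<close> is required to be horizontal, so that brackets of lifts and arbitrary fields can
  stand in the place of \<open>u\<close>.\<close>

lemma g_push:
  assumes u: "u \<in> tangent_space M x" and w: "w \<in> H x"
  shows "g x u w = gB (p x) (push B p u) (push B p w)"
proof -
  obtain a where a: "a \<in> H x" "u - a \<in> V x"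
    using direct_sum_decompose[OF sum u] by blast
  have v: "u - a \<in> tangent_space M x" using a(2) by (simp add: vertical_def)
  have "g x w (u - a) = 0"
    using a(2) w unfolding g_vertical[symmetric] by blast
  then have "g x (u - a) w = 0"
    using riemannian_metric_sym[OF g v H_tangent[OF w]] by simp
  then have "g x u w = g x a w"
    using riemannian_metric_diff[OF g H_tangent[OF w] u H_tangent[OF a(1)]] by simp
  moreover have "push B p u - push B p a = 0"
    using a(2) by (simp add: vertical_def push_diff[symmetric])
  then have "push B p u = push B p a" by (simp only: right_minus_eq)
  ultimately show ?thesis using g_horizontal[OF a(1) w] by simp
qed

lemma push_tangent: "u \<in> tangent_space M x \<Longrightarrow> push B p u \<in> tangent_space B (p x)"
  using push_surj[of x] by blast

text \<open>Both sides are horizontal, and their push-forwards agree by the orthonormal expansion on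
  \<open>B\<close>.\<close>

lemma horizontal_expansion:
  assumes A: "local_orthonormal_basis B (tangent_space B) gB U n A" and x: "p x \<in> U" and u: "u \<in> H x"
  shows "u = (\<Sum>i<n. g x u (lift (A i) x) *\<^sub>R lift (A i) x)"
proof -
  have VF: "A i \<in> vector_fields B" if "i < n" for i
    using A that unfolding local_orthonormal_basis_def by blast
  let ?w = "\<Sum>i<n. g x u (lift (A i) x) *\<^sub>R lift (A i) x"
  have "push B p u = (\<Sum>i<n. gB (p x) (push B p u) (A i (p x)) *\<^sub>R A i (p x))"
  proof (rule orthonormal_expansion[OF subspace_tangent riemannian_metric_linear[OF gB]])
    show "push B p u \<in> span ((\<lambda>i. A i (p x)) ` {..<n})"
      using A x push_tangent[OF H_tangent[OF u]] unfolding local_orthonormal_basis_def by blast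
    show "gB (p x) (A i (p x)) (A j (p x)) = (if i = j then 1 else 0)"
      if "i \<in> {..<n}" "j \<in> {..<n}" for i j
      using A x that unfolding local_orthonormal_basis_def by blast
  qed (auto intro: vector_field_tangent VF)
  also have "\<dots> = (\<Sum>i<n. g x u (lift (A i) x) *\<^sub>R push B p (lift (A i) x))"
    using g_push[OF H_tangent[OF u] lift_H[OF VF]] push_lift[OF VF] by (intro sum.cong) auto
  also have "\<dots> = push B p ?w"
    by (simp only: push_sum push_scale)
  finally have "push B p u = push B p ?w" .
  moreover have "?w \<in> H x"
    by (intro subspace_sum subspace_H subspace_scale lift_H VF) auto
  ultimately show ?thesis using push_inj_H[OF u] by blast
qed

lemma pr_horizontal_expansion:
  assumes A: "local_orthonormal_basis B (tangent_space B) gB U n A" and x: "p x \<in> U"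
    and X: "X \<in> vector_fields M"
  shows "pr H V X x = (\<Sum>i<n. g x (X x) (lift (A i) x) *\<^sub>R lift (A i) x)"
proof -
  note T = vector_field_tangent[OF X]
  have h: "pr H V X x \<in> H x" and v: "X x - pr H V X x \<in> V x"
    using pr_decompose[where T = "tangent_space M", OF sum T] by blast+
  have "g x (pr H V X x) (lift (A i) x) = g x (X x) (lift (A i) x)" if "i < n" for i
  proof -
    have VF: "A i \<in> vector_fields B"
      using A that unfolding local_orthonormal_basis_def by blast
    have "push B p (X x) - push B p (pr H V X x) = 0"
      using v by (simp add: vertical_def push_diff[symmetric])
    then have "push B p (X x) = push B p (pr H V X x)" by (simp only: right_minus_eq)
    then show ?thesis
      using g_push[OF T lift_H[OF VF], of x] g_push[OF H_tangent[OF h] lift_H[OF VF]] by simp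
  qed
  then show ?thesis
    using horizontal_expansion[OF A x h] by simp
qed

text \<open>Near \<open>x\<close> the projection is the expansion in the lifted frame. Its
  coefficients use \<open>X\<close> itself in place of the projection, and are smooth on all of
  \<open>M\<close> because the frame fields are global.\<close>

lemma pr_horizontal_smooth:
  assumes X: "X \<in> vector_fields M"
  shows "pr H V X \<in> vector_fields M"
proof -
  have "(\<lambda>x. pr H V X x f) \<in> smooth_fun M" if f: "f \<in> smooth_fun M" for f
  proof (rule smooth_fun_local[OF atlas])
    fix x
    obtain U n A where U: "p x \<in> U" and A: "local_orthonormal_basis B (tangent_space B) gB U n A"
      using frame by blast
    have VF: "A i \<in> vector_fields B" if "i < n" for i
      using A that unfolding local_orthonormal_basis_def by blast
    let ?F = "\<lambda>y. \<Sum>i<n. g y (X y) (lift (A i) y) * lift (A i) y f"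
    have "open (p -` U)"
      using A continuous by (auto simp: local_orthonormal_basis_def continuous_on_open_vimage)
    moreover have "?F \<in> smooth_fun M"
    proof (rule smooth_fun_sum)
      fix i assume "i \<in> {..<n}"
      then have "lift (A i) \<in> vector_fields M" using lift_smooth[OF VF] by simp
      then show "(\<lambda>y. g y (X y) (lift (A i) y) * lift (A i) y f) \<in> smooth_fun M"
        using riemannian_metric_smooth[OF g X] vector_field_smooth[OF _ f] by (intro smooth_fun_mult)
    qed
    moreover have "?F y = pr H V X y f" if "y \<in> p -` U" for y
      using pr_horizontal_expansion[OF A _ X, of y] that by (simp add: sum_fun_apply)
    ultimately show "\<exists>N F. open N \<and> x \<in> N \<and> F \<in> smooth_fun M \<and> (\<forall>y\<in>N. F y = pr H V X y f)"
      using U by (intro exI[of _ "p -` U"] exI[of _ ?F]) auto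
  qed
  moreover have "pr H V X x \<in> tangent_space M x" for x
    using pr_decompose(1)[where T = "tangent_space M", OF sum vector_field_tangent[OF X]] H_tangent by blast
  ultimately show ?thesis by (simp add: smooth_sections_def)
qed

text \<open>A lift differentiates a function pulled back from \<open>B\<close> as the original field
  does on \<open>B\<close>, and this is applied twice. The bracket itself may have a vertical
  part.\<close>

lemma push_bracket_lift:
  assumes A: "A \<in> vector_fields B" and C: "C \<in> vector_fields B"
  shows "push B p (bracket (lift A) (lift C) x) = bracket A C (p x)"
proof
  fix f
  show "push B p (bracket (lift A) (lift C) x) f = bracket A C (p x) f"
  proof (cases "f \<in> smooth_fun B")
    case True
    then show ?thesis
      using lift_apply[OF A True] lift_apply[OF C True]
        lift_apply[OF A vector_field_smooth[OF C True]] lift_apply[OF C vector_field_smooth[OF A True]]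
      by (simp add: push_def bracket_def compose_fields_def comp_def)
  next
    case False
    then show ?thesis
      using vector_field_nonsmooth[OF bracket_vector_field[OF A C] False] by (simp add: push_def)
  qed
qed

text \<open>All terms of the Koszul formula for horizontal lifts come from the base.\<close>

lemma levi_civita_lift:
  assumes nab: "levi_civita M g nab" and nabB: "levi_civita B gB nabB"
    and A: "A \<in> vector_fields B" and C: "C \<in> vector_fields B"
  shows "pr H V (nab (lift A) (lift C)) = lift (nabB A C)"
proof
  fix x
  obtain U n W where U: "p x \<in> U" and W: "local_orthonormal_basis B (tangent_space B) gB U n W"
    using frame by blast
  have nab_VF: "nab (lift A) (lift C) \<in> vector_fields M" and nabB_VF: "nabB A C \<in> vector_fields B"
    using levi_civita_vector_field[OF nab lift_smooth[OF A] lift_smooth[OF C]]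
      levi_civita_vector_field[OF nabB A C] by blast+
  have g_lift: "g y (lift X y) (lift Y y) = gB (p y) (X (p y)) (Y (p y))"
    if "X \<in> vector_fields B" "Y \<in> vector_fields B" for X Y y
    using g_push[OF H_tangent lift_H, OF lift_H] push_lift that by simp
  \<comment> \<open>The product of two lifts is a function pulled back from
    \<open>B\<close>.\<close>
  have deriv: "lift X x (\<lambda>y. g y (lift Y y) (lift Z y)) = X (p x) (\<lambda>b. gB b (Y b) (Z b))"
    if "X \<in> vector_fields B" "Y \<in> vector_fields B" "Z \<in> vector_fields B" for X Y Z
    using lift_apply[OF that(1) riemannian_metric_smooth[OF gB that(2,3)]] g_lift[OF that(2,3)] by simp
  \<comment> \<open>The vertical part of the bracket is orthogonal to the lift of
    \<open>Z\<close>.\<close>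
  have brk: "g x (bracket (lift X) (lift Y) x) (lift Z x) = gB (p x) (bracket X Y (p x)) (Z (p x))"
    if "X \<in> vector_fields B" "Y \<in> vector_fields B" "Z \<in> vector_fields B" for X Y Z
    using g_push[OF vector_field_tangent[OF bracket_vector_field[OF lift_smooth[OF that(1)]
            lift_smooth[OF that(2)]]] lift_H[OF that(3)]]
      push_lift[OF that(3)] push_bracket_lift[OF that(1,2)] by simp
  have "g x (nab (lift A) (lift C) x) (lift (W i) x) = g x (lift (nabB A C) x) (lift (W i) x)"
    if "i < n" for i
  proof -
    have Wi: "W i \<in> vector_fields B"
      using W that unfolding local_orthonormal_basis_def by blast
    have "2 * g x (nab (lift A) (lift C) x) (lift (W i) x) = 2 * gB (p x) (nabB A C (p x)) (W i (p x))"
      unfolding koszul[OF g nab lift_smooth[OF A] lift_smooth[OF C] lift_smooth[OF Wi]]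
        koszul[OF gB nabB A C Wi]
      using A C Wi by (simp only: deriv brk)
    then show ?thesis using g_lift[OF nabB_VF Wi] by simp
  qed
  \<comment> \<open>Both sides are expanded in the lifted frame, and the coefficients have just been
    shown to agree.\<close>
  then show "pr H V (nab (lift A) (lift C)) x = lift (nabB A C) x"
    using pr_horizontal_expansion[OF W U nab_VF] horizontal_expansion[OF W U lift_H[OF nabB_VF]]
    by simp
qed

lemma adapted_connection_lift:
  assumes nab: "levi_civita M g nab" and nabB: "levi_civita B gB nabB" and A: "A \<in> vector_fields B"
  shows "adapted_connection H V nab (lift A) (lift A) = lift (nabB A A)"
proof -
  note sum' = direct_sum_commute[OF sum]
  note VF = lift_smooth[OF A]
  have h: "pr H V (lift A) = lift A"
    using pr_id[where T = "tangent_space M", OF sum lift_H[OF A]] .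
  have v: "pr V H (lift A) = 0"
    using pr_complement[where T = "tangent_space M", OF sum' vector_field_tangent[OF VF] lift_H[OF A]] .
  have pr0: "pr H V 0 = 0" "pr V H 0 = 0"
  proof -
    show "pr H V 0 = 0"
      by (rule pr_id[where T = "tangent_space M", OF sum])
        (simp only: zero_fun_apply subspace_0[OF subspace_H])
    show "pr V H 0 = 0"
      by (rule pr_id[where T = "tangent_space M", OF sum'])
        (simp only: zero_fun_apply subspace_0[OF subspace_V])
  qed
  have zero: "fun_scale (\<lambda>_. 0) X = 0" for X :: "'m field"
    by (auto simp: fun_eq_iff)
  \<comment> \<open>The axioms of a connection give its value at the zero field through
    function-linearity, with 0 written as 0 times 0.\<close>
  have "nab (fun_scale (\<lambda>_. 0) 0) 0 = fun_scale (\<lambda>_. 0) (nab 0 0)"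
    using nab vector_field_zero[of M] smooth_fun_const[of 0 M]
    unfolding levi_civita_def affine_connection_def by blast
  then have nab0: "nab 0 0 = 0" by (simp only: zero)
  have "lift A x (\<lambda>_. 0) = 0" for x
    using functionals_zero[OF vector_field_functionals[OF VF]] .
  then have "bracket 0 (lift A) = 0" "bracket (lift A) 0 = 0"
    by (auto simp: bracket_def compose_fields_def fun_eq_iff)
  then show ?thesis
    unfolding adapted_connection_def h v pr0 nab0 levi_civita_lift[OF nab nabB A A]
    by (simp add: pr0)
qed

lemma trace_adapted_connection:
  assumes nab: "levi_civita M g nab" and nabB: "levi_civita B gB nabB"
    and A: "local_orthonormal_basis B (tangent_space B) gB U n A" and x: "p x \<in> U"
    and E: "local_orthonormal_basis M H (pullback_metric B p gB) W m E" and x': "x \<in> W"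
  shows "(\<Sum>j<m. second_covariant (adapted_connection H V nab) (E j) (E j) x) =
    (\<Sum>i<n. compose_fields (lift (A i)) (lift (A i)) x - lift (nabB (A i) (A i)) x)"
proof -
  have AVF: "A i \<in> vector_fields B" if "i < n" for i
    using A that unfolding local_orthonormal_basis_def by blast
  have AON: "gB (p x) (A i (p x)) (A k (p x)) = (if i = k then 1 else 0)" if "i < n" "k < n" for i k
    using A that x unfolding local_orthonormal_basis_def by blast
  have EVF: "E j \<in> vector_fields M" if "j < m" for j
    using E that unfolding local_orthonormal_basis_def by blast
  have EH: "E j y \<in> H y" if "j < m" "y \<in> W" for j y
    using E that span_superset[of "(\<lambda>i. E i y) ` {..<m}"] unfolding local_orthonormal_basis_def by blast
  have Espan: "span ((\<lambda>j. E j x) ` {..<m}) = H x"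
    using E x' unfolding local_orthonormal_basis_def by blast
  have EON: "g x (E i x) (E j x) = (if i = j then 1 else 0)" if "i < m" "j < m" for i j
    using E that x' g_horizontal[OF EH[OF that(1) x'] EH[OF that(2) x']]
    unfolding local_orthonormal_basis_def pullback_metric_def by simp
  \<comment> \<open>The transition coefficients are smooth on all of \<open>M\<close>, since the
    fields of both frames are global; only the frame properties are local.\<close>
  let ?c = "\<lambda>j i y. g y (E j y) (lift (A i) y)"
  have nab_affine: "affine_connection M (adapted_connection H V nab)"
    using nab sum pr_horizontal_smooth unfolding levi_civita_def
    by (intro adapted_connection_affine) blast+
  have "(\<Sum>j<m. second_covariant (adapted_connection H V nab) (E j) (E j) x) =
      (\<Sum>i<n. second_covariant (adapted_connection H V nab) (lift (A i)) (lift (A i)) x)"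
  proof (rule trace_second_covariant_frame[OF atlas nab_affine, where U = "W \<inter> p -` U" and c = ?c])
    show "open (W \<inter> p -` U)"
      using A E continuous by (auto simp: local_orthonormal_basis_def continuous_on_open_vimage)
    show "E j y = (\<Sum>i<n. ?c j i y *\<^sub>R lift (A i) y)" if "j \<in> {..<m}" "y \<in> W \<inter> p -` U" for j y
      using horizontal_expansion[OF A _ EH] that by blast
    show "(\<Sum>j<m. ?c j i x * ?c j k x) = (if i = k then 1 else 0)"
      if ik: "i \<in> {..<n}" "k \<in> {..<n}" for i k
    proof -
      have i: "lift (A i) x \<in> H x" and k: "lift (A k) x \<in> H x"
        using lift_H[OF AVF] ik by auto
      have ET: "E j x \<in> tangent_space M x" if "j < m" for j
        using H_tangent[OF EH[OF that x']] .
      \<comment> \<open>Column orthogonality is the Parseval identity: the lift of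
        \<open>A i\<close> is expanded in the orthonormal basis \<open>E\<close> at \<open>x\<close>
        and paired with the lift of \<open>A k\<close>.\<close>
      have "lift (A i) x = (\<Sum>j<m. g x (lift (A i) x) (E j x) *\<^sub>R E j x)"
        using EON ET i Espan
        by (intro orthonormal_expansion[OF subspace_tangent riemannian_metric_linear[OF g]]) auto
      then have "g x (lift (A i) x) (lift (A k) x) =
          g x (\<Sum>j<m. g x (lift (A i) x) (E j x) *\<^sub>R E j x) (lift (A k) x)"
        by metis
      also have "\<dots> = (\<Sum>j<m. g x (g x (lift (A i) x) (E j x) *\<^sub>R E j x) (lift (A k) x))"
        using ET by (intro linear_between_sum[OF riemannian_metric_linear[OF g H_tangent[OF k]]
              subspace_tangent] subspace_scale[OF subspace_tangent]) auto
      also have "\<dots> = (\<Sum>j<m. ?c j i x * ?c j k x)"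
      proof (intro sum.cong refl)
        fix j assume "j \<in> {..<m}"
        then have j: "E j x \<in> tangent_space M x" using ET by simp
        show "g x (g x (lift (A i) x) (E j x) *\<^sub>R E j x) (lift (A k) x) = ?c j i x * ?c j k x"
          using riemannian_metric_linear[OF g H_tangent[OF k]] j
            riemannian_metric_sym[OF g H_tangent[OF i] j]
          unfolding linear_between_def by simp
      qed
      finally have "(\<Sum>j<m. ?c j i x * ?c j k x) = g x (lift (A i) x) (lift (A k) x)" ..
      also have "\<dots> = gB (p x) (A i (p x)) (A k (p x))"
        using g_horizontal[OF i k] push_lift[OF AVF] ik by simp
      finally show ?thesis using AON ik by simp
    qed
    show "?c j i \<in> smooth_fun M" if "j \<in> {..<m}" "i \<in> {..<n}" for j i
      using that by (intro riemannian_metric_smooth[OF g] EVF lift_smooth AVF) auto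
  qed (use x x' EVF lift_smooth[OF AVF] in auto)
  also have "\<dots> = (\<Sum>i<n. compose_fields (lift (A i)) (lift (A i)) x - lift (nabB (A i) (A i)) x)"
    using adapted_connection_lift[OF nab nabB AVF]
    by (intro sum.cong) (auto simp only: second_covariant_def minus_apply lessThan_iff)
  finally show ?thesis .
qed

end

text \<open>Squares are anticommutators, so the defining property of the induced 2-connection, with
  both fields equal, gives the image of \<open>A A\<close> under \<open>hS\<close>.\<close>

lemma anticommutator_self: "anticommutator X X = compose_fields X X"
  unfolding anticommutator_def by (rule scaleR_half_double)

theorem proposition2p3:
  fixes M :: "('m::{t2_space, second_countable_topology}, 'e::euclidean_space) atlas"
    and B :: "('b::{t2_space, second_countable_topology}, 'c::euclidean_space) atlas"
    and \<pi> :: "'m \<Rightarrow> 'b"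
    and gB :: "'b metric"
    and H :: "'m \<Rightarrow> 'm functional set"
    and \<Delta>B :: "'b field"
    and \<Delta>' :: "'m field"
    and hS :: "'m \<Rightarrow> 'b functional \<Rightarrow> 'm functional"
  assumes "connected_manifold M" and "connected_manifold B"
    and "submersion M B \<pi>" and "surj \<pi>"
    and "riemannian_metric B gB" and "is_laplacian B gB \<Delta>B"
    and "ehresmann_connection M B \<pi> H"
    and "is_sub_laplacian M H (pullback_metric B \<pi> gB) (vertical M B \<pi>) \<Delta>'"
    and "induced_two_connection M B \<pi> H hS"
  shows "(\<lambda>x. hS x (\<Delta>B (\<pi> x))) = \<Delta>'"
proof
  fix x
  obtain nabB where nabB: "levi_civita B gB nabB"
    and \<Delta>B: "is_trace_operator B (tangent_space B) gB nabB \<Delta>B"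
    using assms(6) unfolding is_laplacian_def by blast
  obtain g nab where g: "riemannian_metric M g"
    and gH: "\<And>x u v. u \<in> H x \<Longrightarrow> v \<in> H x \<Longrightarrow> g x u v = pullback_metric B \<pi> gB x u v"
    and gV: "\<And>x. {w \<in> tangent_space M x. \<forall>u\<in>H x. g x u w = 0} = vertical M B \<pi> x"
    and nab: "levi_civita M g nab"
    and \<Delta>': "is_trace_operator M H (pullback_metric B \<pi> gB)
        (adapted_connection H (vertical M B \<pi>) nab) \<Delta>'"
    using assms(8) unfolding is_sub_laplacian_def by blast
  have sum: "direct_sum (tangent_space M x) (H x) (vertical M B \<pi> x)" for x
    using assms(7) unfolding ehresmann_connection_def by blast
  have hS: "two_connection M B \<pi> hS"
    and hS_tangent: "\<And>x u. u \<in> tangent_space B (\<pi> x) \<Longrightarrow> hS x u = hlift B \<pi> H x u"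
    and hS_anticommutator: "\<And>A Z x. A \<in> vector_fields B \<Longrightarrow> Z \<in> vector_fields B \<Longrightarrow>
      hS x (anticommutator A Z (\<pi> x)) = anticommutator (hlift_field B \<pi> H A) (hlift_field B \<pi> H Z) x"
    using assms(9) unfolding induced_two_connection_def by blast+
  \<comment> \<open>Every point of \<open>B\<close> lies in the domain of one of the frames that
    compute the Laplacian.\<close>
  have frame: "\<exists>U n A. b \<in> U \<and> local_orthonormal_basis B (tangent_space B) gB U n A" for b
    using \<Delta>B unfolding is_trace_operator_def by blast
  have push_surj: "push B \<pi> ` tangent_space M x = tangent_space B (\<pi> x)" for x
    using assms(3) unfolding submersion_def by blast
  have lift_tangent: "hlift B \<pi> H x u \<in> tangent_space M x" if "u \<in> tangent_space B (\<pi> x)" for x u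
  proof -
    have "hS x ` tangent_space B (\<pi> x) \<subseteq> tangent_space M x"
      using hS unfolding two_connection_def schwartz_morphism_def by blast
    then show ?thesis using hS_tangent[OF that] that by force
  qed
  have lift_smooth: "hlift_field B \<pi> H A \<in> vector_fields M" if A: "A \<in> vector_fields B" for A
  proof -
    \<comment> \<open>As an operator of order at most two, \<open>A\<close> falls under the
      smoothness clause for \<open>hS\<close>, which agrees with the lift on \<open>A\<close>. That
      the result has tangent values is supplied by \<open>lift_tangent\<close>.\<close>
    have "A \<in> operators2 B"
      using A tangent_subset_tangent2 unfolding smooth_sections_def by fast
    then have "(\<lambda>x. hS x (A (\<pi> x))) \<in> operators2 M"
      using hS unfolding two_connection_def by blast
    then have "hlift_field B \<pi> H A \<in> operators2 M"
      using hS_tangent[OF vector_field_tangent[OF A]] by (simp add: hlift_field_def)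
    then show ?thesis
      using lift_tangent[OF vector_field_tangent[OF A]] by (simp add: smooth_sections_def hlift_field_def)
  qed
  interpret horizontal_lift M B \<pi> H gB g
  proof
    show "smooth_atlas M" using assms(1) by (simp add: connected_manifold_def)
    show "continuous_on UNIV \<pi>" using assms(3) by (simp add: submersion_def smooth_map_def)
    show "g x u v = gB (\<pi> x) (push B \<pi> u) (push B \<pi> v)" if "u \<in> H x" "v \<in> H x" for x u v
      using gH[OF that] by (simp add: pullback_metric_def)
  qed (fact push_surj sum lift_smooth assms(5) g gV frame)+
  obtain U n A where U: "\<pi> x \<in> U" and A: "local_orthonormal_basis B (tangent_space B) gB U n A"
    and eqB: "\<forall>b\<in>U. \<Delta>B b = (\<Sum>i<n. second_covariant nabB (A i) (A i) b)"
    using spec[OF \<Delta>B[unfolded is_trace_operator_def], of "\<pi> x"] by (elim exE conjE)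
  note \<Delta>B_eq = bspec[OF eqB U]
  obtain W m E where W: "x \<in> W" and E: "local_orthonormal_basis M H (pullback_metric B \<pi> gB) W m E"
    and eq': "\<forall>y\<in>W. \<Delta>' y = (\<Sum>j<m. second_covariant (adapted_connection H V nab) (E j) (E j) y)"
    using spec[OF \<Delta>'[unfolded is_trace_operator_def], of x] by (elim exE conjE)
  note \<Delta>'_eq = bspec[OF eq' W]
  have AVF: "A i \<in> vector_fields B" if "i < n" for i
    using A that unfolding local_orthonormal_basis_def by blast
  have nabVF: "nabB X X \<in> vector_fields B" if "X \<in> vector_fields B" for X
    using levi_civita_vector_field[OF nabB that that] .
  have lin: "linear_between (tangent2_space B (\<pi> x)) (tangent2_space M x) (hS x)"
    using hS unfolding two_connection_def schwartz_morphism_def by blast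
  \<comment> \<open>\<open>hS x\<close> is linear only on second order vectors, so both parts of the
    second covariant derivative must be placed there before it is applied to their
    difference.\<close>
  have T2: "compose_fields X X (\<pi> x) \<in> tangent2_space B (\<pi> x)"
      "nabB X X (\<pi> x) \<in> tangent2_space B (\<pi> x)" if "X \<in> vector_fields B" for X
    using compose_fields_tangent2[OF that that]
      subsetD[OF tangent_subset_tangent2 vector_field_tangent[OF nabVF[OF that]]] by blast+
  have second: "second_covariant nabB X X (\<pi> x) = compose_fields X X (\<pi> x) - nabB X X (\<pi> x)" for X
    by (simp add: second_covariant_def)
  have hS_second: "hS x (second_covariant nabB X X (\<pi> x)) =
      compose_fields (lift X) (lift X) x - lift (nabB X X) x" if X: "X \<in> vector_fields B" for X
  proof -
    have "hS x (second_covariant nabB X X (\<pi> x)) =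
        hS x (compose_fields X X (\<pi> x)) - hS x (nabB X X (\<pi> x))"
      unfolding second
      by (rule linear_between_diff[OF lin subspace_tangent2 T2[OF X]])
    also have "hS x (compose_fields X X (\<pi> x)) = compose_fields (lift X) (lift X) x"
      using hS_anticommutator[OF X X] by (simp add: anticommutator_self)
    also have "hS x (nabB X X (\<pi> x)) = lift (nabB X X) x"
      using hS_tangent[OF vector_field_tangent[OF nabVF[OF X]]] by (simp add: hlift_field_def)
    finally show ?thesis .
  qed
  have second_T2: "second_covariant nabB X X (\<pi> x) \<in> tangent2_space B (\<pi> x)"
    if "X \<in> vector_fields B" for X
    unfolding second
    using subspace_diff[OF subspace_tangent2 T2[OF that]] .
  have "hS x (\<Delta>B (\<pi> x)) = (\<Sum>i<n. hS x (second_covariant nabB (A i) (A i) (\<pi> x)))"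
    unfolding \<Delta>B_eq by (rule linear_between_sum[OF lin subspace_tangent2 second_T2]) (use AVF in auto)
  also have "\<dots> = (\<Sum>i<n. compose_fields (lift (A i)) (lift (A i)) x - lift (nabB (A i) (A i)) x)"
    using hS_second AVF by (intro sum.cong) auto
  also have "\<dots> = \<Delta>' x"
    unfolding \<Delta>'_eq by (rule trace_adapted_connection[OF nab nabB A U E W, symmetric])
  finally show "hS x (\<Delta>B (\<pi> x)) = \<Delta>' x" .
qed

end
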